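(* Let $m\ge1$. For all $d_0\in[-1,0]$ (and $d_V>2m-1$), the function $V$ defined in the context is positive definite, and there exist positive real numbers $k_1,\dots,k_m$, $\ell_1,\dots,\ell_{m-1}$ and $\tilde\lambda$ such that for all $\bar e\in\mathbb R^m$ $$\max\left\{\frac{\partial V}{\partial\bar e}(\bar e)\left(S_m\bar e+\mathfrak K(\bar e_1)\right)\right\}\le-\tilde\lambda\,V(\bar e)^{\frac{d_V+d_0}{d_V}},$$ where the maximum is over the possible values of the (set-valued when $d_0=-1$) term $\mathfrak K(\bar e_1)$.
   Context: Signed power: $\lfloor a\rceil^b=\mathrm{sign}(a)|a|^b$ for $b>0$; $\lfloor a\rceil^0$ is any element of the set $\mathrm S(a)$, where $\mathrm S(a)=\{1\}$ if $a>0$, $[-1,1]$ if $a=0$, $\{-1\}$ if $a<0$. Weights: $r_i=1-d_0(m-i)$ for $i=1,\dots,m+1$. $S_m$ is the $m\times m$ shifting matrix: $(S_m e)_i=e_{i+1}$ for $i<m$ and $(S_me)_m=0$. The correction term $\mathfrak K$ has components $$(\mathfrak K(e_1))_i=-k_i\lfloor e_1\rceil^{\frac{r_{i+1}}{r_1}},\quad i=1,\dots,m,$$ so that when $d_0=-1$ ($r_{m+1}=0$) its last component is the set $-k_m\mathrm S(e_1)$. The function $V:\mathbb R^m\to\mathbb R_+$ is $$V(\bar e)=\sum_{i=1}^{m-1}\int_{\lfloor\bar e_{i+1}\rceil^{\frac{r_i}{r_{i+1}}}}^{\ell_i\bar e_i}\left[\lfloor x\rceil^{\frac{d_V-r_i}{r_i}}-\lfloor\bar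 e_{i+1}\rceil^{\frac{d_V-r_i}{r_{i+1}}}\right]dx+\frac{|\bar e_m|^{d_V}}{d_V},$$ where $d_V$ and the $\ell_i$ are positive real numbers with $d_V>2m-1$. *)

theory Defs
  imports "HOL-Analysis.Analysis"
begin

text \<open>
  The space of dimension \<open>m\<close> is \<^typ>\<open>real ^ 'm\<close> with \<open>m = CARD('m)\<close>. Since \<open>'m\<close> carries no order,
  the coordinates are numbered \<open>1, \<dots>, m\<close> by a bijection \<open>pos\<close> from \<open>'m\<close> to \<open>{1..CARD('m)}\<close>.
\<close>

definition coord :: "('m::finite \<Rightarrow> nat) \<Rightarrow> real ^ 'm \<Rightarrow> nat \<Rightarrow> real" where
  "coord pos e i = e $ inv pos i"

definition sign_set :: "real \<Rightarrow> real set" where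
  "sign_set a = (if a > 0 then {1} else if a = 0 then {-1..1} else {-1})"

text \<open>
  The single-valued signed power is meant for exponents \<open>b > 0\<close> only. The exponent \<open>0\<close> is
  covered by the set-valued version.
\<close>

definition spow :: "real \<Rightarrow> real \<Rightarrow> real" where
  "spow a b = sgn a * \<bar>a\<bar> powr b"

definition spow_set :: "real \<Rightarrow> real \<Rightarrow> real set" where
  "spow_set a b = (if b = 0 then sign_set a else {spow a b})"

definition weight :: "nat \<Rightarrow> real \<Rightarrow> nat \<Rightarrow> real" where
  "weight m d0 i = 1 - d0 * (real m - real i)"

definition shift :: "('m::finite \<Rightarrow> nat) \<Rightarrow> real ^ 'm \<Rightarrow> real ^ 'm" where
  "shift pos e = (\<chi> j. if pos j < CARD('m) then coord pos e (pos j + 1) else 0)"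

text \<open>The set of all possible values of the correction term for gains \<open>k\<close>.\<close>

definition correction ::
    "('m::finite \<Rightarrow> nat) \<Rightarrow> real \<Rightarrow> (nat \<Rightarrow> real) \<Rightarrow> real \<Rightarrow> (real ^ 'm) set" where
  "correction pos d0 k e1 =
     {v. \<forall>i\<in>{1..CARD('m)}. \<exists>s \<in> spow_set e1 (weight CARD('m) d0 (i + 1) / weight CARD('m) d0 1).
           coord pos v i = - k i * s}"

text \<open>The integral is oriented: its lower bound may exceed the upper one.\<close>

definition V ::
    "('m::finite \<Rightarrow> nat) \<Rightarrow> real \<Rightarrow> real \<Rightarrow> (nat \<Rightarrow> real) \<Rightarrow> real ^ 'm \<Rightarrow> real" where
  "V pos d0 dV l e =
     (let m = CARD('m); r = weight m d0; x = coord pos e in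
       (\<Sum>i = 1..<m.
          LBINT t = ereal (spow (x (i + 1)) (r i / r (i + 1)))..ereal (l i * x i).
            spow t ((dV - r i) / r i) - spow (x (i + 1)) ((dV - r i) / r (i + 1)))
       + \<bar>x m\<bar> powr dV / dV)"

definition positive_definite :: "('a::real_vector \<Rightarrow> real) \<Rightarrow> bool" where
  "positive_definite f \<longleftrightarrow> f 0 = 0 \<and> (\<forall>x. x \<noteq> 0 \<longrightarrow> f x > 0)"

definition is_maximum :: "real set \<Rightarrow> real \<Rightarrow> bool" where
  "is_maximum A M \<longleftrightarrow> M \<in> A \<and> (\<forall>x\<in>A. x \<le> M)"

text \<open>
  The values of the directional derivative \<open>\<partial>V/\<partial>e (e) (S e + K(e\<^sub>1))\<close> over all
  selections from the correction term.
\<close>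

definition V_dot_set ::
    "('m::finite \<Rightarrow> nat) \<Rightarrow> real \<Rightarrow> real \<Rightarrow> (nat \<Rightarrow> real) \<Rightarrow> (nat \<Rightarrow> real) \<Rightarrow> real ^ 'm \<Rightarrow> real set" where
  "V_dot_set pos d0 dV l k e =
     (\<lambda>\<kappa>. frechet_derivative (V pos d0 dV l) (at e) (shift pos e + \<kappa>))
       ` correction pos d0 k (coord pos e 1)"

end

theory Submission
  imports Defs
begin

text \<open>
  Each term of \<open>V\<close> is the defect in Young's inequality for \<open>\<ell>\<^sub>i e\<^sub>i\<close> and a signed power of
  \<open>e\<^bsub>i+1\<^esub>\<close>. The gains are chosen by downward induction on \<open>j\<close>, for the subchains
  \<open>e\<^sub>j, \<dots>, e\<^sub>m\<close>. Adding \<open>e\<^sub>j\<close> to the subchain from \<open>e\<^bsub>j+1\<^esub>\<close> on amounts to driving the latter's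
  correction by \<open>a = \<lfloor>\<ell>\<^sub>j e\<^sub>j\<rceil>\<close> (to the power \<open>r\<^bsub>j+1\<^esub>/r\<^sub>j\<close>) instead of \<open>e\<^bsub>j+1\<^esub>\<close>. The resulting
  errors are homogeneous of degree \<open>d\<^sub>V + d\<^sub>0\<close> and contain a positive power of \<open>a - e\<^bsub>j+1\<^esub>\<close>, so
  they are at most a small multiple of the homogeneous norm plus a large multiple of
  \<open>\<bar>a - e\<^bsub>j+1\<^esub>\<bar>\<close> to the power \<open>(d\<^sub>V + d\<^sub>0)/r\<^bsub>j+1\<^esub>\<close>. The derivative along \<open>e\<^sub>j\<close> produces \<open>- \<ell>\<^sub>j\<close>
  times the latter quantity, and \<open>\<ell>\<^sub>j\<close> is taken large.

  When \<open>d\<^sub>0 = -1\<close> the last correction is discontinuous and a wrong sign of \<open>a\<close> is not a small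
  error. The induction therefore admits arbitrary values in \<open>[-1, 1]\<close> for the last signed power,
  at the cost of a penalty that vanishes on the values in \<open>S(e\<^sub>j)\<close>.
\<close>

subsection \<open>Signed powers\<close>

lemma abs_spow [simp]: "\<bar>spow a b\<bar> = \<bar>a\<bar> powr b"
  by (auto simp: spow_def abs_mult sgn_if)

lemma spow_0 [simp]: "spow 0 b = 0"
  by (simp add: spow_def)

lemma spow_minus: "spow (- a) b = - spow a b"
  by (simp add: spow_def sgn_if)

lemma spow_nonneg: "0 \<le> a \<Longrightarrow> spow a b = a powr b"
  by (auto simp: spow_def sgn_if)

lemma spow_nonpos: "a \<le> 0 \<Longrightarrow> spow a b = - (\<bar>a\<bar> powr b)"
  by (auto simp: spow_def sgn_if)

lemma sgn_spow [simp]: "sgn (spow a b) = sgn a"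
  by (auto simp: spow_def sgn_if zero_less_mult_iff)

lemma spow_spow: "spow (spow a b) c = spow a (b * c)"
proof -
  have "spow (spow a b) c = sgn (spow a b) * \<bar>spow a b\<bar> powr c"
    by (rule spow_def)
  then show ?thesis unfolding sgn_spow abs_spow powr_powr by (simp add: spow_def)
qed

lemma spow_one [simp]: "spow a 1 = a"
  by (auto simp: spow_def sgn_if)

lemma spow_scale: "l > 0 \<Longrightarrow> spow (l * a) b = l powr b * spow a b"
  by (simp add: spow_def sgn_mult abs_mult powr_mult)

lemma spow_mult_spow: "spow a b * spow a c = \<bar>a\<bar> powr (b + c)"
  by (auto simp: spow_def sgn_if powr_add)

lemma abs_powr_mult_spow: "\<bar>a\<bar> powr b * spow a c = spow a (b + c)"
  by (simp add: spow_def powr_add)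

lemma compact_spow_set: "compact (spow_set a b)"
  by (simp add: spow_set_def sign_set_def)

lemma spow_set_nonempty: "spow_set a b \<noteq> {}"
  by (simp add: spow_set_def sign_set_def)

lemma spow_mono:
  assumes "b \<ge> 0" "x \<le> y"
  shows "spow x b \<le> spow y b"
proof -
  consider "0 \<le> x" | "x \<le> 0" "0 \<le> y" | "y \<le> 0" using assms by linarith
  then show ?thesis
  proof cases
    case 1 then show ?thesis using assms by (simp add: spow_nonneg powr_mono2)
  next
    case 2
    then show ?thesis using assms
      by (simp add: spow_nonneg spow_nonpos) (smt (verit) powr_ge_zero)
  next
    case 3 then show ?thesis using assms by (simp add: spow_nonpos powr_mono2)
  qed
qed

section \<open>Inequalities for powers of sums and differences\<close>

text \<open>After division by \<open>u + v\<close> the two arguments add up to \<open>1\<close>, and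
  \<open>t \<le> t powr \<theta>\<close> on \<open>[0, 1]\<close>.\<close>

lemma powr_add_le:
  fixes u v \<theta> :: real
  assumes "0 < \<theta>" "\<theta> \<le> 1" "0 \<le> u" "0 \<le> v"
  shows "(u + v) powr \<theta> \<le> u powr \<theta> + v powr \<theta>"
proof (cases "u + v = 0")
  case False
  then have s: "u + v > 0" using assms by simp
  have *: "t / (u + v) \<le> (t / (u + v)) powr \<theta>" if "0 \<le> t" "t \<le> u + v" for t
    using powr_mono'[of \<theta> 1 "t / (u + v)"] that s assms by simp
  have "1 = u / (u + v) + v / (u + v)" using s by (simp flip: add_divide_distrib)
  also have "\<dots> \<le> (u / (u + v)) powr \<theta> + (v / (u + v)) powr \<theta>"
    using *[of u] *[of v] assms by simp
  also have "\<dots> = (u powr \<theta> + v powr \<theta>) / (u + v) powr \<theta>"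
    using s assms by (simp add: powr_divide add_divide_distrib)
  finally show ?thesis using s by (simp add: field_simps)
qed (use assms in simp)

lemma powr_add_le2:
  fixes u v p :: real
  assumes "0 \<le> p" "0 \<le> u" "0 \<le> v"
  shows "(u + v) powr p \<le> 2 powr p * (u powr p + v powr p)"
proof -
  have "(u + v) powr p \<le> (2 * max u v) powr p"
    using assms by (intro powr_mono2) auto
  also have "\<dots> = 2 powr p * max u v powr p" using assms by (simp add: powr_mult)
  also have "\<dots> \<le> 2 powr p * (u powr p + v powr p)"
    by (intro mult_left_mono) (auto simp: max_def)
  finally show ?thesis .
qed

text \<open>Numbers of equal sign are covered by subadditivity, if necessary after negating both.
  For opposite signs each power separately is at most
  \<open>\<bar>a - b\<bar> powr \<theta>\<close>, hence the factor \<open>2\<close>.\<close>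

lemma spow_diff_le_Hoelder:
  assumes "0 < \<theta>" "\<theta> \<le> 1"
  shows "\<bar>spow a \<theta> - spow b \<theta>\<bar> \<le> 2 * \<bar>a - b\<bar> powr \<theta>"
proof -
  have same: "\<bar>spow a \<theta> - spow b \<theta>\<bar> \<le> 2 * \<bar>a - b\<bar> powr \<theta>" if "0 \<le> b" "b \<le> a" for a b
  proof -
    have "a powr \<theta> \<le> b powr \<theta> + (a - b) powr \<theta>"
      using powr_add_le[OF assms, of b "a - b"] that by simp
    moreover have "b powr \<theta> \<le> a powr \<theta>" using that assms by (intro powr_mono2) auto
    ultimately show ?thesis using that by (simp add: spow_nonneg)
  qed
  have opp: "\<bar>spow a \<theta> - spow b \<theta>\<bar> \<le> 2 * \<bar>a - b\<bar> powr \<theta>" if "b \<le> 0" "0 \<le> a" for a b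
  proof -
    have "a powr \<theta> \<le> (a - b) powr \<theta>" "\<bar>b\<bar> powr \<theta> \<le> (a - b) powr \<theta>"
      using that assms by (auto intro!: powr_mono2)
    then show ?thesis using that by (simp add: spow_nonneg spow_nonpos)
  qed
  have ge: "\<bar>spow a \<theta> - spow b \<theta>\<bar> \<le> 2 * \<bar>a - b\<bar> powr \<theta>" if "b \<le> a" for a b
  proof -
    consider "0 \<le> b" | "b \<le> 0" "0 \<le> a" | "a \<le> 0" by linarith
    then show ?thesis
    proof cases
      case 3
      then show ?thesis using same[of "- a" "- b"] that by (simp add: spow_minus abs_minus_commute)
    qed (use same opp that in auto)
  qed
  show ?thesis using ge[of a b] ge[of b a] by (cases a b rule: le_cases) (auto simp: abs_minus_commute)
qed

text \<open>The inverse map has exponent \<open>1/\<gamma>\<close> and is Hoelder continuous. Read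
  backwards, that estimate bounds the increment of the power from below, and monotonicity settles
  the sign. This is the source of the negative term that the gain \<open>L\<close> amplifies
  later.\<close>

lemma spow_coercive:
  assumes "\<gamma> \<ge> 1"
  shows "(a - b) * (spow a \<gamma> - spow b \<gamma>) \<ge> (1/2) powr \<gamma> * \<bar>a - b\<bar> powr (\<gamma> + 1)"
proof (cases "a = b")
  case False
  have "\<bar>a - b\<bar> \<le> 2 * \<bar>spow a \<gamma> - spow b \<gamma>\<bar> powr (1/\<gamma>)"
    using spow_diff_le_Hoelder[of "1/\<gamma>" "spow a \<gamma>" "spow b \<gamma>"] assms by (simp add: spow_spow)
  then have "(1/2 * \<bar>a - b\<bar>) powr \<gamma> \<le> (\<bar>spow a \<gamma> - spow b \<gamma>\<bar> powr (1/\<gamma>)) powr \<gamma>"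
    using assms by (intro powr_mono2) auto
  then have "(1/2 * \<bar>a - b\<bar>) powr \<gamma> \<le> \<bar>spow a \<gamma> - spow b \<gamma>\<bar>"
    using assms by (simp add: powr_powr)
  then have 1: "\<bar>a - b\<bar> * ((1/2) powr \<gamma> * \<bar>a - b\<bar> powr \<gamma>) \<le> \<bar>a - b\<bar> * \<bar>spow a \<gamma> - spow b \<gamma>\<bar>"
    by (intro mult_left_mono) (simp_all add: powr_divide)
  have 2: "\<bar>a - b\<bar> * \<bar>spow a \<gamma> - spow b \<gamma>\<bar> = (a - b) * (spow a \<gamma> - spow b \<gamma>)"
  proof (cases a b rule: le_cases)
    case le
    then show ?thesis using spow_mono[of \<gamma> a b] assms by (simp add: algebra_simps)
  next
    case ge
    then show ?thesis using spow_mono[of \<gamma> b a] assms by (simp add: algebra_simps)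
  qed
  have "\<bar>a - b\<bar> powr (\<gamma> + 1) = \<bar>a - b\<bar> * \<bar>a - b\<bar> powr \<gamma>"
    using False by (simp add: powr_add)
  then show ?thesis using 1 2 by (simp add: mult_ac)
qed simp

section \<open>Regularity of signed powers\<close>

lemma tendsto_powr_pos_zero:
  assumes "p > 0"
  shows "((\<lambda>h::real. \<bar>h\<bar> powr p) \<longlongrightarrow> 0) (at 0)"
  by (rule tendsto_zero_powrI) (use assms in \<open>auto intro!: tendsto_eq_intros\<close>)

lemma DERIV_eventually_eq:
  fixes f :: "real \<Rightarrow> real"
  assumes "open S" "x \<in> S" "\<And>t. t \<in> S \<Longrightarrow> f t = g t" "DERIV g x :> D"
  shows "DERIV f x :> D"
  using assms DERIV_cong_ev[of x x f g D D] eventually_nhds by (auto simp: eventually_nhds)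

text \<open>Away from \<open>0\<close> this is the usual power rule. At \<open>0\<close> the
  difference quotient is bounded by \<open>\<bar>h\<bar> powr (p - 1)\<close>, which tends to
  \<open>0\<close> because \<open>p > 1\<close>.\<close>

lemma DERIV_abs_powr:
  assumes "p > 1"
  shows "DERIV (\<lambda>t. \<bar>t\<bar> powr p) x :> p * spow x (p - 1)"
proof -
  consider "x > 0" | "x < 0" | "x = 0" by linarith
  then show ?thesis
  proof cases
    case 1
    then have "DERIV (\<lambda>t. t powr p) x :> p * spow x (p - 1)"
      by (auto intro!: derivative_eq_intros simp: spow_nonneg)
    then show ?thesis using 1
      by (rule_tac DERIV_eventually_eq[where S = "{0<..}"]) auto
  next
    case 2
    then have "DERIV (\<lambda>t. (- t) powr p) x :> p * spow x (p - 1)"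
      by (auto intro!: derivative_eq_intros simp: spow_nonpos)
    then show ?thesis using 2
      by (rule_tac DERIV_eventually_eq[where S = "{..<0}"]) auto
  next
    case 3
    have "((\<lambda>h::real. \<bar>h\<bar> powr p / h) \<longlongrightarrow> 0) (at 0)"
    proof (rule Lim_null_comparison)
      show "\<forall>\<^sub>F h::real in at 0. norm (\<bar>h\<bar> powr p / h) \<le> \<bar>h\<bar> powr (p - 1)"
        by (auto simp: eventually_at powr_diff intro!: exI[of _ 1])
    qed (use assms tendsto_powr_pos_zero in auto)
    then show ?thesis using 3 by (simp add: has_field_derivative_iff)
  qed
qed

lemma DERIV_spow:
  assumes "p > 1"
  shows "DERIV (\<lambda>t. spow t p) x :> p * \<bar>x\<bar> powr (p - 1)"
proof -
  consider "x > 0" | "x < 0" | "x = 0" by linarith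
  then show ?thesis
  proof cases
    case 1
    then have "DERIV (\<lambda>t. t powr p) x :> p * \<bar>x\<bar> powr (p - 1)"
      by (auto intro!: derivative_eq_intros)
    then show ?thesis using 1
      by (rule_tac DERIV_eventually_eq[where S = "{0<..}"]) (auto simp: spow_nonneg)
  next
    case 2
    then have "DERIV (\<lambda>t. - ((- t) powr p)) x :> p * \<bar>x\<bar> powr (p - 1)"
      by (auto intro!: derivative_eq_intros)
    then show ?thesis using 2
      by (rule_tac DERIV_eventually_eq[where S = "{..<0}"]) (auto simp: spow_nonpos)
  next
    case 3
    have "((\<lambda>h::real. spow h p / h) \<longlongrightarrow> 0) (at 0)"
    proof (rule Lim_null_comparison)
      show "\<forall>\<^sub>F h::real in at 0. norm (spow h p / h) \<le> \<bar>h\<bar> powr (p - 1)"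
        by (auto simp: eventually_at powr_diff intro!: exI[of _ 1])
    qed (use assms tendsto_powr_pos_zero in auto)
    then show ?thesis using 3 by (simp add: has_field_derivative_iff)
  qed
qed

lemma continuous_on_spow:
  assumes "b > 0"
  shows "continuous_on S (\<lambda>t. spow t b)"
proof -
  \<comment> \<open>Splitting into positive and negative parts, with \<open>0 powr b = 0\<close>,
    reduces continuity to nonnegative bases.\<close>
  have "spow t b = max t 0 powr b - max (- t) 0 powr b" for t
    using assms by (auto simp: spow_def sgn_if max_def)
  then show ?thesis
    using assms by (simp only:) (intro continuous_intros continuous_on_powr', auto)
qed

lemma spow_diff_le_Lipschitz:
  assumes "\<rho> \<ge> 1" "\<bar>a\<bar> \<le> K" "\<bar>b\<bar> \<le> K"
  shows "\<bar>spow a \<rho> - spow b \<rho>\<bar> \<le> \<rho> * K powr (\<rho> - 1) * \<bar>a - b\<bar>"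
proof (cases "\<rho> = 1 \<or> a = b")
  case True
  show ?thesis
  \<comment> \<open>\<open>0 powr 0\<close> is \<open>0\<close>, so for \<open>\<rho> = 1\<close>
    the Lipschitz constant degenerates at \<open>K = 0\<close>; there \<open>a\<close> and
    \<open>b\<close> are both \<open>0\<close>.\<close>
  proof (cases "K = 0")
    case False
    with True show ?thesis by auto
  qed (use assms in auto)
next
  case False
  have "norm (spow a \<rho> - spow b \<rho>) \<le> \<rho> * K powr (\<rho> - 1) * norm (a - b)"
  proof (rule field_differentiable_bound[where S = "{-K..K}"])
    show "norm (\<rho> * \<bar>z\<bar> powr (\<rho> - 1)) \<le> \<rho> * K powr (\<rho> - 1)" if "z \<in> {-K..K}" for z
      using that assms by (auto simp: abs_mult intro!: mult_left_mono powr_mono2)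
  qed (use assms False in \<open>auto intro!: DERIV_spow has_field_derivative_at_within[OF DERIV_spow]\<close>)
  then show ?thesis by simp
qed

text \<open>Where \<open>w\<close> is at most a small multiple of \<open>R\<close>, the factor
  \<open>w powr q\<close> provides the smallness. Elsewhere \<open>R\<close> is at most a multiple
  of \<open>w\<close>, and the whole product goes into the second term.\<close>

lemma Young_homogeneous:
  fixes p q \<epsilon> :: real
  assumes "0 \<le> p" "0 < q" "0 < \<epsilon>"
  obtains C where "C \<ge> 0"
    "\<And>R w. 0 \<le> R \<Longrightarrow> 0 \<le> w \<Longrightarrow> (R + w) powr p * w powr q \<le> \<epsilon> * R powr (p + q) + C * w powr (p + q)"
proof -
  \<comment> \<open>The second entry of the minimum gives
    \<open>2 powr p * \<delta> powr q \<le> \<epsilon>\<close>; the first gives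
    \<open>R + w \<le> 2 * R\<close> as soon as \<open>w \<le> \<delta> * R\<close>.\<close>
  define \<delta> where "\<delta> = min 1 ((\<epsilon> / 2 powr p) powr (1 / q))"
  have d: "0 < \<delta>" "\<delta> \<le> 1" using assms by (auto simp: \<delta>_def)
  have "\<delta> powr q \<le> ((\<epsilon> / 2 powr p) powr (1 / q)) powr q"
    using assms d by (intro powr_mono2) (auto simp: \<delta>_def)
  then have dq: "2 powr p * \<delta> powr q \<le> \<epsilon>" using assms by (simp add: powr_powr field_simps)
  define C where "C = (1 / \<delta> + 1) powr p"
  have "(R + w) powr p * w powr q \<le> \<epsilon> * R powr (p + q) + C * w powr (p + q)"
    if "0 \<le> R" "0 \<le> w" for R w
  proof (cases "w \<le> \<delta> * R")
    case True
    have "w \<le> R" using True d that by (smt (verit) mult_left_le_one_le)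
    then have "(R + w) powr p * w powr q \<le> (2 * R) powr p * (\<delta> * R) powr q"
      using that True assms by (intro mult_mono powr_mono2) auto
    also have "\<dots> = (2 powr p * \<delta> powr q) * R powr (p + q)"
      using that d by (simp add: powr_mult powr_add)
    also have "\<dots> \<le> \<epsilon> * R powr (p + q)" by (intro mult_right_mono dq) auto
    finally show ?thesis by (smt (verit) C_def mult_nonneg_nonneg powr_ge_zero)
  next
    case False
    then have "R \<le> w / \<delta>" using d by (simp add: field_simps)
    then have "(R + w) powr p \<le> ((1 / \<delta> + 1) * w) powr p"
      using that assms by (intro powr_mono2) (auto simp: algebra_simps)
    then have "(R + w) powr p * w powr q \<le> ((1 / \<delta> + 1) * w) powr p * w powr q"
      by (intro mult_right_mono) auto
    also have "\<dots> = C * w powr (p + q)"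
      using that d by (simp add: C_def powr_mult powr_add)
    finally show ?thesis using assms by (smt (verit) mult_nonneg_nonneg powr_ge_zero)
  qed
  then show ?thesis by (intro that[of C]) (auto simp: C_def)
qed

subsection \<open>Negligible perturbations\<close>

text \<open>The order of quantifiers is that of the absorption argument: first
  \<open>\<epsilon>\<close> is fixed below the available decay in \<open>S\<close>, then a gain is
  chosen against the resulting \<open>C\<close>.\<close>

definition negligible_wrt :: "('b \<Rightarrow> bool) \<Rightarrow> ('b \<Rightarrow> real) \<Rightarrow> ('b \<Rightarrow> real) \<Rightarrow> ('b \<Rightarrow> real) \<Rightarrow> bool" where
  "negligible_wrt P T S U \<longleftrightarrow>
     (\<forall>\<epsilon>>0. \<exists>C\<ge>0. \<forall>t. P t \<longrightarrow> T t \<le> \<epsilon> * S t + C * U t)"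

lemma negligible_wrt_add:
  assumes "negligible_wrt P T1 S U" "negligible_wrt P T2 S U"
  shows "negligible_wrt P (\<lambda>t. T1 t + T2 t) S U"
  unfolding negligible_wrt_def
proof (intro allI impI)
  fix \<epsilon> :: real assume "\<epsilon> > 0"
  then have e: "\<epsilon> / 2 > 0" by simp
  obtain C1 where C1: "C1 \<ge> 0" "\<forall>t. P t \<longrightarrow> T1 t \<le> \<epsilon> / 2 * S t + C1 * U t"
    using assms(1) e unfolding negligible_wrt_def by blast
  obtain C2 where C2: "C2 \<ge> 0" "\<forall>t. P t \<longrightarrow> T2 t \<le> \<epsilon> / 2 * S t + C2 * U t"
    using assms(2) e unfolding negligible_wrt_def by blast
  have "T1 t + T2 t \<le> \<epsilon> * S t + (C1 + C2) * U t" if "P t" for t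
    using C1(2)[rule_format, OF that] C2(2)[rule_format, OF that] by (simp add: algebra_simps)
  with C1(1) C2(1) show "\<exists>C\<ge>0. \<forall>t. P t \<longrightarrow> T1 t + T2 t \<le> \<epsilon> * S t + C * U t"
    by (intro exI[of _ "C1 + C2"]) auto
qed

lemma negligible_wrt_0:
  assumes "\<And>t. S t \<ge> 0"
  shows "negligible_wrt P (\<lambda>t. 0) S U"
  unfolding negligible_wrt_def using assms by (auto intro!: exI[of _ 0])

lemma negligible_wrt_sum:
  assumes "\<And>t. S t \<ge> 0" "\<And>i. i \<in> I \<Longrightarrow> negligible_wrt P (T i) S U"
  shows "negligible_wrt P (\<lambda>t. \<Sum>i\<in>I. T i t) S U"
  using assms(2)
  by (induction I rule: infinite_finite_induct) (simp_all add: negligible_wrt_0 negligible_wrt_add assms(1))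

text \<open>The form in which homogeneous errors appear: any positive power \<open>q\<close> of
  \<open>w\<close>, however small, suffices.\<close>

lemma negligible_wrt_product:
  fixes R w :: "'b \<Rightarrow> real"
  assumes "0 \<le> p" "0 < q" "0 \<le> K" "\<And>t. 0 \<le> R t" "\<And>t. 0 \<le> w t"
    and "\<And>t. P t \<Longrightarrow> T t \<le> K * ((R t + w t) powr p * w t powr q)"
  shows "negligible_wrt P T (\<lambda>t. R t powr (p + q)) (\<lambda>t. w t powr (p + q))"
  unfolding negligible_wrt_def
proof (intro allI impI)
  fix \<epsilon> :: real assume e: "\<epsilon> > 0"
  \<comment> \<open>Dividing by \<open>K + 1\<close> instead of \<open>K\<close> admits
    \<open>K = 0\<close>.\<close>
  then have "\<epsilon> / (K + 1) > 0" using assms by simp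
  then obtain C where C: "C \<ge> 0" "\<And>R w. 0 \<le> R \<Longrightarrow> 0 \<le> w \<Longrightarrow>
      (R + w) powr p * w powr q \<le> \<epsilon> / (K + 1) * R powr (p + q) + C * w powr (p + q)"
    using Young_homogeneous[OF assms(1,2)] by blast
  have "T t \<le> \<epsilon> * R t powr (p + q) + (K * C) * w t powr (p + q)" if "P t" for t
  proof -
    have "T t \<le> K * (\<epsilon> / (K + 1) * R t powr (p + q) + C * w t powr (p + q))"
      using assms(6)[OF that] mult_left_mono[OF C(2)[OF assms(4,5)] assms(3), of t t] by linarith
    also have "\<dots> = (K / (K + 1)) * (\<epsilon> * R t powr (p + q)) + (K * C) * w t powr (p + q)"
      by (simp add: algebra_simps)
    also have "\<dots> \<le> 1 * (\<epsilon> * R t powr (p + q)) + (K * C) * w t powr (p + q)"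
      using assms(3) e C(1) by (intro add_mono mult_right_mono) auto
    finally show ?thesis by simp
  qed
  then show "\<exists>C\<ge>0. \<forall>t. P t \<longrightarrow> T t \<le> \<epsilon> * R t powr (p + q) + C * w t powr (p + q)"
    using assms(3) C(1) by (intro exI[of _ "K * C"]) auto
qed

text \<open>Bookkeeping of homogeneity: with \<open>R\<close> as the homogeneous norm, a quantity of
  weight \<open>\<rho>\<close> raised to the power \<open>p\<close> has weight
  \<open>\<rho> * p\<close>.\<close>

lemma powr_le_of_weighted_le:
  fixes u R \<rho> p :: real
  assumes "\<bar>u\<bar> \<le> K * R powr \<rho>" "0 \<le> K" "0 \<le> p"
  shows "\<bar>u\<bar> powr p \<le> K powr p * R powr (\<rho> * p)"
proof -
  have "\<bar>u\<bar> powr p \<le> (K * R powr \<rho>) powr p" using assms by (intro powr_mono2) auto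
  then show ?thesis using assms by (simp add: powr_mult powr_powr)
qed

subsection \<open>Stabilisation of the chain\<close>

text \<open>At exponent \<open>0\<close> the sign of \<open>x\<close> is ignored on purpose: the
  induction changes the driving variable but keeps this value, and \<open>penalty\<close> accounts
  for a wrong sign.\<close>

definition selection :: "real \<Rightarrow> real \<Rightarrow> real \<Rightarrow> bool" where
  "selection \<theta> x s \<longleftrightarrow> (if \<theta> = 0 then \<bar>s\<bar> \<le> 1 else s = spow x \<theta>)"

locale homogeneous_chain =
  fixes m :: nat and d0 dV :: real
  assumes m_ge_1: "1 \<le> m" and d0: "d0 \<in> {-1..0}" and dV: "dV > 2 * real m - 1"
begin

definition r :: "nat \<Rightarrow> real" where "r = weight m d0"

text \<open>The degree of homogeneity of the derivative of \<open>V\<close> along the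
  system.\<close>

definition D :: real where "D = dV + d0"

text \<open>At \<open>z = l i * x i\<close> and \<open>y = x (Suc i)\<close> this is the closed form
  of the \<open>i\<close>-th integral: the defect in Young's inequality with the conjugate exponents
  \<open>dV / r i\<close> and \<open>dV / (dV - r i)\<close>.\<close>

definition W :: "nat \<Rightarrow> real \<Rightarrow> real \<Rightarrow> real" where
  "W i z y = r i / dV * \<bar>z\<bar> powr (dV / r i) + (1 - r i / dV) * \<bar>y\<bar> powr (dV / r (Suc i))
     - z * spow y ((dV - r i) / r (Suc i))"

definition W_z :: "nat \<Rightarrow> real \<Rightarrow> real \<Rightarrow> real" where
  "W_z i z y = spow z ((dV - r i) / r i) - spow y ((dV - r i) / r (Suc i))"

text \<open>\<open>W_z\<close> and \<open>W_y\<close> are the partial derivatives of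
  \<open>W\<close>. This one is factored so that its zero at
  \<open>z = spow y (r i / r (Suc i))\<close> is visible.\<close>

definition W_y :: "nat \<Rightarrow> real \<Rightarrow> real \<Rightarrow> real" where
  "W_y i z y = (dV - r i) / r (Suc i) * \<bar>y\<bar> powr ((dV - r i) / r (Suc i) - 1)
     * (spow y (r i / r (Suc i)) - z)"

text \<open>The subchain \<open>x\<^sub>j, \<dots>, x\<^sub>m\<close> has its own Lyapunov function, the terms of \<open>V\<close> with index at
  least \<open>j\<close>, and its correction term is driven by \<open>x\<^sub>j\<close>. The \<open>s i\<close> stand for the values of the
  signed powers of \<open>x\<^sub>j\<close>.\<close>

definition grad :: "nat \<Rightarrow> (nat \<Rightarrow> real) \<Rightarrow> (nat \<Rightarrow> real) \<Rightarrow> nat \<Rightarrow> real" where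
  "grad j l x i =
     (if i = m then spow (x m) (dV - 1) else l i * W_z i (l i * x i) (x (Suc i)))
     + (if j < i then W_y (i - 1) (l (i - 1) * x (i - 1)) (x i) else 0)"

definition drift :: "(nat \<Rightarrow> real) \<Rightarrow> nat \<Rightarrow> real" where
  "drift x i = (if i < m then x (Suc i) else 0)"

definition Vdot ::
    "nat \<Rightarrow> (nat \<Rightarrow> real) \<Rightarrow> (nat \<Rightarrow> real) \<Rightarrow> (nat \<Rightarrow> real) \<Rightarrow> (nat \<Rightarrow> real) \<Rightarrow> real" where
  "Vdot j l k x s = (\<Sum>i = j..m. grad j l x i * (drift x i - k i * s i))"

text \<open>As \<open>x i\<close> has weight \<open>r i\<close>, all summands have degree
  \<open>D\<close>: this is the \<open>D\<close>-th power of a homogeneous norm.\<close>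

definition hsize :: "nat \<Rightarrow> (nat \<Rightarrow> real) \<Rightarrow> real" where
  "hsize j x = (\<Sum>i = j..m. \<bar>x i\<bar> powr (D / r i))"

text \<open>On admissible values it can be nonzero only if \<open>r (Suc m) = 0\<close>. Its degree
  \<open>D\<close> is that of \<open>hsize\<close>.\<close>

definition penalty :: "nat \<Rightarrow> real \<Rightarrow> real \<Rightarrow> real" where
  "penalty j a t = (if t \<in> spow_set a (r (Suc m) / r j) then 0 else \<bar>a\<bar> powr (D / r j))"

definition admissible :: "nat \<Rightarrow> real \<Rightarrow> (nat \<Rightarrow> real) \<Rightarrow> bool" where
  "admissible j a s \<longleftrightarrow> (\<forall>i\<in>{j..m}. selection (r (Suc i) / r j) a (s i))"

definition stabilisable :: "nat \<Rightarrow> bool" where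
  "stabilisable j \<longleftrightarrow> (\<exists>k l lam C. (\<forall>i\<in>{j..m}. k i > 0) \<and> (\<forall>i\<in>{j..<m}. l i > 0) \<and> lam > 0 \<and> C \<ge> 0 \<and>
     (\<forall>x s. admissible j (x j) s \<longrightarrow> Vdot j l k x s \<le> - lam * hsize j x + C * penalty j (x j) (s m)))"

section \<open>Weights and the homogeneous norm\<close>

lemma r_m [simp]: "r m = 1"
  by (simp add: r_def weight_def)

lemma r_Suc: "r (Suc i) = r i + d0"
  by (simp add: r_def weight_def algebra_simps)

lemma r_ge_1: "i \<le> m \<Longrightarrow> r i \<ge> 1"
  using d0 by (simp add: r_def weight_def mult_nonpos_nonneg)

lemma r_pos [simp]: "i \<le> m \<Longrightarrow> r i > 0"
  using r_ge_1[of i] by linarith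

lemma r_nonneg [simp]: "i \<le> m \<Longrightarrow> 0 \<le> r i"
  using r_pos[of i] by linarith

lemma r_nonzero [simp]: "i \<le> m \<Longrightarrow> r i \<noteq> 0"
  using r_pos[of i] by linarith

lemma r_Suc_nonneg: "i \<le> m \<Longrightarrow> r (Suc i) \<ge> 0"
  using r_ge_1[of i] r_Suc[of i] d0 by auto

lemma r_Suc_le: "r (Suc i) \<le> r i"
  using r_Suc[of i] d0 by auto

lemma r_mono: "i \<le> j \<Longrightarrow> r j \<le> r i"
  by (induction rule: dec_induct) (use r_Suc_le order_trans in blast)+

text \<open>The sum is \<open>2 - d0 * (2 * m - 2 * i - 1)\<close>, at most \<open>2 * m - 1\<close>
  because \<open>-d0 \<le> 1\<close> and \<open>i \<ge> 1\<close>. It follows that the exponent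
  \<open>(dV - r i) / r (Suc i)\<close> exceeds \<open>1\<close>, on which differentiability of
  \<open>W\<close> and coercivity rely.\<close>

lemma r_sum_less:
  assumes "1 \<le> i" "i < m"
  shows "r i + r (Suc i) < dV"
proof -
  have "- d0 * (2 * real m - 2 * real i - 1) \<le> 1 * (2 * real m - 2 * real i - 1)"
    using d0 assms by (intro mult_right_mono) auto
  then have "r i + r (Suc i) \<le> 2 + (2 * real m - 2 * real i - 1)"
    by (simp add: r_def weight_def algebra_simps)
  then show ?thesis using dV assms by simp
qed

lemma r_less_dV:
  assumes "1 \<le> i" "i \<le> m"
  shows "r i < dV"
proof (cases "i = m")
  case False
  then have "r (Suc i) > 0" "r i + r (Suc i) < dV" using assms r_sum_less[of i] by auto
  then show ?thesis by linarith
qed (use m_ge_1 dV in auto)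

lemma dV_gt_1: "dV > 1"
  using m_ge_1 dV by auto

lemma D_pos: "D > 0"
  using d0 dV_gt_1 by (auto simp: D_def)

lemma hsize_nonneg: "hsize j x \<ge> 0"
  unfolding hsize_def by (intro sum_nonneg) auto

text \<open>\<open>hsize j x powr (1 / D)\<close> is the homogeneous norm, called \<open>R\<close>
  in the estimates below.\<close>

lemma abs_le_hsize:
  assumes "i \<in> {j..m}"
  shows "\<bar>x i\<bar> \<le> (hsize j x powr (1 / D)) powr r i"
proof -
  have "\<bar>x i\<bar> powr (D / r i) \<le> hsize j x"
    unfolding hsize_def by (rule member_le_sum) (use assms in auto)
  then have "(\<bar>x i\<bar> powr (D / r i)) powr (r i / D) \<le> hsize j x powr (r i / D)"
    using D_pos assms r_pos[of i] by (intro powr_mono2) auto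
  then show ?thesis using D_pos assms r_pos[of i] by (simp add: powr_powr)
qed

section \<open>Growth of the gradient\<close>

lemma W_z_bound:
  assumes "1 \<le> i" "i < m" "0 \<le> c"
  obtains K where "0 \<le> K" "\<And>R z y. \<bar>z\<bar> \<le> c * R powr r i \<Longrightarrow> \<bar>y\<bar> \<le> R powr r (Suc i) \<Longrightarrow>
    \<bar>W_z i z y\<bar> \<le> K * R powr (dV - r i)"
proof -
  have ri: "r i < dV" "r i > 0" "r (Suc i) > 0" using assms r_less_dV[of i] by auto
  define K where "K = c powr ((dV - r i) / r i) + 1"
  have "\<bar>W_z i z y\<bar> \<le> K * R powr (dV - r i)"
    if "\<bar>z\<bar> \<le> c * R powr r i" "\<bar>y\<bar> \<le> R powr r (Suc i)" for R z y
  proof -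
    have "\<bar>W_z i z y\<bar> \<le> \<bar>z\<bar> powr ((dV - r i) / r i) + \<bar>y\<bar> powr ((dV - r i) / r (Suc i))"
      unfolding W_z_def by (rule order_trans[OF abs_triangle_ineq4]) simp
    also have "\<dots> \<le> c powr ((dV - r i) / r i) * R powr (r i * ((dV - r i) / r i))
        + 1 powr ((dV - r i) / r (Suc i)) * R powr (r (Suc i) * ((dV - r i) / r (Suc i)))"
      using that ri assms by (intro add_mono powr_le_of_weighted_le) auto
    also have "\<dots> = K * R powr (dV - r i)"
      using ri by (simp add: K_def distrib_right)
    finally show ?thesis .
  qed
  then show ?thesis by (intro that[of K]) (auto simp: K_def)
qed

lemma W_y_bound:
  assumes "1 \<le> i" "i < m" "0 \<le> c"
  obtains K where "0 \<le> K" "\<And>R z y. \<bar>z\<bar> \<le> c * R powr r i \<Longrightarrow> \<bar>y\<bar> \<le> R powr r (Suc i) \<Longrightarrow>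
    \<bar>W_y i z y\<bar> \<le> K * R powr (dV - r (Suc i))"
proof -
  have ri: "r i < dV" "r i > 0" "r (Suc i) > 0" "r i + r (Suc i) < dV"
    using assms r_less_dV[of i] r_sum_less[of i] by auto
  define \<gamma> where "\<gamma> = (dV - r i) / r (Suc i)"
  have g: "\<gamma> > 1" using ri by (simp add: \<gamma>_def field_simps)
  define K where "K = \<gamma> * (1 + c)"
  have "\<bar>W_y i z y\<bar> \<le> K * R powr (dV - r (Suc i))"
    if "\<bar>z\<bar> \<le> c * R powr r i" "\<bar>y\<bar> \<le> R powr r (Suc i)" for R z y
  proof -
    have 1: "\<bar>y\<bar> powr (\<gamma> - 1) \<le> 1 powr (\<gamma> - 1) * R powr (r (Suc i) * (\<gamma> - 1))"
      using that g by (intro powr_le_of_weighted_le) auto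
    have "\<bar>y\<bar> powr (r i / r (Suc i)) \<le> 1 powr (r i / r (Suc i)) * R powr (r (Suc i) * (r i / r (Suc i)))"
      using that ri by (intro powr_le_of_weighted_le) auto
    then have "\<bar>spow y (r i / r (Suc i))\<bar> \<le> R powr r i"
      using ri by simp
    then have 2: "\<bar>spow y (r i / r (Suc i)) - z\<bar> \<le> (1 + c) * R powr r i"
      using that(1) abs_triangle_ineq4[of "spow y (r i / r (Suc i))" z] by (simp add: algebra_simps)
    have "\<bar>W_y i z y\<bar> = \<gamma> * (\<bar>y\<bar> powr (\<gamma> - 1) * \<bar>spow y (r i / r (Suc i)) - z\<bar>)"
      unfolding W_y_def using g by (simp add: abs_mult flip: \<gamma>_def)
    also have "\<dots> \<le> \<gamma> * (R powr (r (Suc i) * (\<gamma> - 1)) * ((1 + c) * R powr r i))"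
      using 1 2 g by (intro mult_left_mono mult_mono) auto
    also have "\<dots> = K * R powr (r (Suc i) * (\<gamma> - 1) + r i)"
      by (simp add: K_def powr_add)
    also have "r (Suc i) * (\<gamma> - 1) + r i = dV - r (Suc i)"
      using ri by (simp add: \<gamma>_def field_simps)
    finally show ?thesis .
  qed
  then show ?thesis using g assms by (intro that[of K]) (auto simp: K_def)
qed

text \<open>Component \<open>i\<close> collects contributions of two consecutive terms of the
  Lyapunov function. Both have degree \<open>dV - r i\<close>, so they are bounded separately and
  added.\<close>

lemma grad_bound:
  assumes "1 \<le> j" "i \<in> {j..m}"
  obtains K where "0 \<le> K" "\<And>R x. (\<And>i. i \<in> {j..m} \<Longrightarrow> \<bar>x i\<bar> \<le> R powr r i) \<Longrightarrow>
    \<bar>grad j l x i\<bar> \<le> K * R powr (dV - r i)"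
proof -
  have scale: "\<bar>l i * x i\<bar> \<le> \<bar>l i\<bar> * R powr r i" if "\<bar>x i\<bar> \<le> R powr r i" for x i R
    using that by (simp add: abs_mult mult_left_mono)
  obtain K1 where K1: "0 \<le> K1" "\<And>R x. (\<And>i. i \<in> {j..m} \<Longrightarrow> \<bar>x i\<bar> \<le> R powr r i) \<Longrightarrow>
    \<bar>if i = m then spow (x m) (dV - 1) else l i * W_z i (l i * x i) (x (Suc i))\<bar> \<le> K1 * R powr (dV - r i)"
  proof (cases "i = m")
    case True
    show ?thesis
    proof (rule that[of 1])
      fix R x assume "\<And>i. i \<in> {j..m} \<Longrightarrow> \<bar>x i\<bar> \<le> R powr r i"
      from this[of m] have "\<bar>x m\<bar> \<le> 1 * R powr r m" using assms by simp
      then have "\<bar>x m\<bar> powr (dV - 1) \<le> 1 powr (dV - 1) * R powr (r m * (dV - 1))"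
        using dV_gt_1 by (intro powr_le_of_weighted_le) auto
      then show "\<bar>if i = m then spow (x m) (dV - 1) else l i * W_z i (l i * x i) (x (Suc i))\<bar>
        \<le> 1 * R powr (dV - r i)" using True by simp
    qed simp
  next
    case False
    then have i: "1 \<le> i" "i < m" using assms by auto
    obtain K where K: "0 \<le> K" "\<And>R z y. \<bar>z\<bar> \<le> \<bar>l i\<bar> * R powr r i \<Longrightarrow> \<bar>y\<bar> \<le> R powr r (Suc i) \<Longrightarrow>
      \<bar>W_z i z y\<bar> \<le> K * R powr (dV - r i)" by (rule W_z_bound[OF i abs_ge_zero[of "l i"]]) blast
    show ?thesis
    proof (rule that[of "\<bar>l i\<bar> * K"])
      fix R x assume "\<And>i. i \<in> {j..m} \<Longrightarrow> \<bar>x i\<bar> \<le> R powr r i"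
      then have "\<bar>x i\<bar> \<le> R powr r i" "\<bar>x (Suc i)\<bar> \<le> R powr r (Suc i)" using assms i by auto
      then have "\<bar>W_z i (l i * x i) (x (Suc i))\<bar> \<le> K * R powr (dV - r i)"
        using K(2) scale by blast
      then show "\<bar>if i = m then spow (x m) (dV - 1) else l i * W_z i (l i * x i) (x (Suc i))\<bar>
        \<le> (\<bar>l i\<bar> * K) * R powr (dV - r i)"
        using False by (simp add: abs_mult mult_left_mono mult.assoc)
    qed (use K in auto)
  qed
  obtain K2 where K2: "0 \<le> K2" "\<And>R x. (\<And>i. i \<in> {j..m} \<Longrightarrow> \<bar>x i\<bar> \<le> R powr r i) \<Longrightarrow>
    \<bar>if j < i then W_y (i - 1) (l (i - 1) * x (i - 1)) (x i) else 0\<bar> \<le> K2 * R powr (dV - r i)"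
  proof (cases "j < i")
    case False
    then show ?thesis by (intro that[of 0]) auto
  next
    case True
    then have i: "1 \<le> i - 1" "i - 1 < m" "Suc (i - 1) = i" using assms by auto
    obtain K where K: "0 \<le> K" "\<And>R z y. \<bar>z\<bar> \<le> \<bar>l (i - 1)\<bar> * R powr r (i - 1) \<Longrightarrow>
      \<bar>y\<bar> \<le> R powr r i \<Longrightarrow> \<bar>W_y (i - 1) z y\<bar> \<le> K * R powr (dV - r i)"
      using W_y_bound[OF i(1,2) abs_ge_zero[of "l (i - 1)"]] unfolding i(3) by blast
    show ?thesis
    proof (rule that[of K])
      fix R x assume *: "\<And>i. i \<in> {j..m} \<Longrightarrow> \<bar>x i\<bar> \<le> R powr r i"
      have "\<bar>x (i - 1)\<bar> \<le> R powr r (i - 1)" "\<bar>x i\<bar> \<le> R powr r i"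
        by (rule *, use assms True in auto)+
      then have "\<bar>W_y (i - 1) (l (i - 1) * x (i - 1)) (x i)\<bar> \<le> K * R powr (dV - r i)"
        using K(2) scale by blast
      then show "\<bar>if j < i then W_y (i - 1) (l (i - 1) * x (i - 1)) (x i) else 0\<bar>
        \<le> K * R powr (dV - r i)" using True by simp
    qed (use K in auto)
  qed
  show ?thesis
  proof (rule that[of "K1 + K2"])
    fix R x assume *: "\<And>i. i \<in> {j..m} \<Longrightarrow> \<bar>x i\<bar> \<le> R powr r i"
    show "\<bar>grad j l x i\<bar> \<le> (K1 + K2) * R powr (dV - r i)"
      unfolding grad_def distrib_right
      by (rule order_trans[OF abs_triangle_ineq add_mono[OF K1(2) K2(2)]]) (use * in auto)
  qed (use K1 K2 in auto)
qed

text \<open>With unit gain the derivative is \<open>- hsize\<close> if \<open>s m\<close> fits the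
  sign of \<open>x m\<close>. If not, it is at most \<open>hsize\<close>, which then equals the
  penalty; the factor \<open>2\<close> compensates for both.\<close>

lemma stabilisable_m: "stabilisable m"
proof -
  have main: "Vdot m l (\<lambda>_. 1) x s \<le> - 1 * hsize m x + 2 * penalty m (x m) (s m)"
    if "admissible m (x m) s" for l x s
  proof -
    have s: "selection (r (Suc m)) (x m) (s m)" using that by (simp add: admissible_def)
    have eq: "Vdot m l (\<lambda>_. 1) x s = - (spow (x m) (dV - 1) * s m)"
      by (simp add: Vdot_def grad_def drift_def)
    show ?thesis
    proof (cases "r (Suc m) = 0")
      case True
      then have d: "D = dV - 1" by (simp add: r_Suc D_def)
      show ?thesis
      proof (cases "s m \<in> sign_set (x m)")
        case True
        then have "spow (x m) (dV - 1) * s m = \<bar>x m\<bar> powr (dV - 1)"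
          by (auto simp: sign_set_def spow_def sgn_if split: if_splits)
        then show ?thesis using True \<open>r (Suc m) = 0\<close> d
          by (simp add: eq hsize_def penalty_def spow_set_def)
      next
        case False
        have "\<bar>spow (x m) (dV - 1) * s m\<bar> \<le> \<bar>x m\<bar> powr (dV - 1) * 1"
          unfolding abs_mult using s True by (intro mult_mono) (auto simp: selection_def)
        then have "- (spow (x m) (dV - 1) * s m) \<le> \<bar>x m\<bar> powr (dV - 1)"
          unfolding abs_le_iff by simp
        moreover have "hsize m x = \<bar>x m\<bar> powr (dV - 1)"
          "penalty m (x m) (s m) = \<bar>x m\<bar> powr (dV - 1)"
          using True False d by (simp_all add: hsize_def penalty_def spow_set_def)
        ultimately show ?thesis unfolding eq by simp
      qed
    next
      case False
      have "spow (x m) (dV - 1) * spow (x m) (1 + d0) = \<bar>x m\<bar> powr D"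
        by (simp add: spow_mult_spow D_def)
      then show ?thesis using s False
        by (simp add: eq hsize_def penalty_def selection_def spow_set_def r_Suc)
    qed
  qed
  show ?thesis unfolding stabilisable_def
    by (rule exI[of _ "\<lambda>_. 1"], rule exI[of _ "\<lambda>_. 1"], rule exI[of _ 1], rule exI[of _ 2])
      (use main in auto)
qed

section \<open>Errors from changing the driving variable\<close>

text \<open>\<open>\<bar>a - x n\<bar> powr (1 / r n)\<close> has weight \<open>1\<close>, like the
  homogeneous norm, so it can serve as \<open>w\<close> in
  \<open>negligible_wrt_product\<close>.\<close>

lemma negligible_chainI:
  assumes "n \<in> {1..m}" "0 \<le> p" "0 < q" "p + q = D" "0 \<le> K"
    and "\<And>x a s. admissible n a s \<Longrightarrow>
      T x a s \<le> K * ((hsize n x powr (1 / D) + \<bar>a - x n\<bar> powr (1 / r n)) powr p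
                      * (\<bar>a - x n\<bar> powr (1 / r n)) powr q)"
  shows "negligible_wrt (\<lambda>(x, a, s). admissible n a s) (\<lambda>(x, a, s). T x a s)
    (\<lambda>(x, a, s). hsize n x) (\<lambda>(x, a, s). \<bar>a - x n\<bar> powr (D / r n))"
proof -
  let ?R = "\<lambda>(x, a :: real, s :: nat \<Rightarrow> real). hsize n x powr (1 / D)"
  let ?w = "\<lambda>(x, a :: real, s :: nat \<Rightarrow> real). \<bar>a - x n\<bar> powr (1 / r n)"
  have "negligible_wrt (\<lambda>(x, a, s). admissible n a s) (\<lambda>(x, a, s). T x a s)
    (\<lambda>t. ?R t powr (p + q)) (\<lambda>t. ?w t powr (p + q))"
    by (rule negligible_wrt_product[OF assms(2,3,5)]) (use assms(6) in auto)
  moreover have "(\<lambda>t. ?R t powr (p + q)) = (\<lambda>(x, a, s). hsize n x)"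
    using D_pos hsize_nonneg by (auto simp: fun_eq_iff assms(4) powr_powr)
  moreover have "(\<lambda>t. ?w t powr (p + q)) = (\<lambda>(x, a, s). \<bar>a - x n\<bar> powr (D / r n))"
    by (auto simp: fun_eq_iff assms(4) powr_powr)
  ultimately show ?thesis by simp
qed

text \<open>Since \<open>r j / r (Suc j) \<ge> 1\<close>, the difference of signed powers in
  \<open>W_y\<close> is Lipschitz, which yields the factor \<open>\<bar>a - x (Suc j)\<bar>\<close>.
  The second factor only has to be bounded, so a discontinuous selection does no harm.\<close>

lemma negligible_coupling:
  assumes "1 \<le> j" "j < m"
  shows "negligible_wrt (\<lambda>(x, a, s). admissible (Suc j) a s)
    (\<lambda>(x, a, s). W_y j (spow a (r j / r (Suc j))) (x (Suc j)) * (drift x (Suc j) - \<kappa> * s (Suc j)))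
    (\<lambda>(x, a, s). hsize (Suc j) x) (\<lambda>(x, a, s). \<bar>a - x (Suc j)\<bar> powr (D / r (Suc j)))"
proof -
  define n where "n = Suc j"
  have n: "n \<in> {1..m}" "n \<le> m" using assms by (auto simp: n_def)
  have rn: "r n > 0" "r j > 0" "r n \<le> r j" "r j < dV" "r j + r n < dV" "r (Suc n) \<ge> 0" "r (Suc n) \<le> r n"
    using assms n r_Suc_le[of j] r_Suc_le[of n] r_less_dV[of j] r_sum_less[of j] r_Suc_nonneg[of n]
    by (auto simp: n_def)
  define \<gamma> where "\<gamma> = (dV - r j) / r n"
  define \<rho> where "\<rho> = r j / r n"
  define \<theta> where "\<theta> = r (Suc n) / r n"
  have g: "\<gamma> > 1" "\<rho> \<ge> 1" "0 \<le> \<theta>" using rn by (simp_all add: \<gamma>_def \<rho>_def \<theta>_def field_simps)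
  \<comment> \<open>The degree that remains of \<open>D\<close> after
    \<open>w powr r n = \<bar>a - x n\<bar>\<close> is split off; it is nonnegative because
    \<open>2 * r n \<le> r j + r n < dV\<close>.\<close>
  define p where "p = dV - 2 * r n + r (Suc n)"
  have p: "0 \<le> p" "p + r n = D" using rn by (auto simp: p_def D_def r_Suc)
  define K1 where "K1 = \<gamma> * \<rho> * 2 powr (\<rho> - 1)"
  define K2 where "K2 = 1 + \<bar>\<kappa>\<bar> * (2 powr \<theta>)"
  have K: "0 \<le> K1" "0 \<le> K2" using g by (auto simp: K1_def K2_def)
  have "W_y j (spow a \<rho>) (x n) * (drift x n - \<kappa> * s n)
    \<le> (K1 * K2) * ((hsize n x powr (1 / D) + \<bar>a - x n\<bar> powr (1 / r n)) powr p
                      * (\<bar>a - x n\<bar> powr (1 / r n)) powr r n)"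
    if adm: "admissible n a s" for x a s
  proof -
    define R where "R = hsize n x powr (1 / D)"
    define w where "w = \<bar>a - x n\<bar> powr (1 / r n)"
    define M where "M = R + w"
    have nn: "0 \<le> R" "0 \<le> w" "0 \<le> M" by (auto simp: R_def w_def M_def)
    have xi: "\<bar>x i\<bar> \<le> M powr r i" if "i \<in> {n..m}" for i
    proof -
      have "\<bar>x i\<bar> \<le> R powr r i" unfolding R_def by (rule abs_le_hsize[OF that])
      also have "\<dots> \<le> M powr r i" using that nn by (intro powr_mono2) (auto simp: M_def)
      finally show ?thesis .
    qed
    have wn: "w powr r n = \<bar>a - x n\<bar>" using rn by (simp add: w_def powr_powr)
    have "w powr r n \<le> M powr r n" using nn rn by (intro powr_mono2) (auto simp: M_def)
    then have aM: "\<bar>a\<bar> \<le> 2 * M powr r n" using xi[of n] n wn by simp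
    have xM: "\<bar>x n\<bar> \<le> 2 * M powr r n" using xi[of n] n by simp
    show ?thesis
    \<comment> \<open>For \<open>M = 0\<close> also \<open>M powr 0\<close> is \<open>0\<close> and
      would not bound \<open>s n\<close> when \<open>r (Suc n) = 0\<close>; there \<open>W_y\<close>
      itself vanishes.\<close>
    proof (cases "M = 0")
      case True
      then have "a = 0" "x n = 0" using aM xM by auto
      then show ?thesis using K by (simp add: W_y_def)
    next
      case False
      then have M: "M > 0" using nn by simp
      have H: "\<bar>W_y j (spow a \<rho>) (x n)\<bar> \<le> K1 * (M powr (dV - 2 * r n) * w powr r n)"
      proof -
        have "\<bar>x n\<bar> powr (\<gamma> - 1) \<le> 1 powr (\<gamma> - 1) * M powr (r n * (\<gamma> - 1))"
          using xi[of n] n g by (intro powr_le_of_weighted_le) auto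
        moreover have "r n * (\<gamma> - 1) = dV - r j - r n" using rn by (simp add: \<gamma>_def field_simps)
        ultimately have 1: "\<bar>x n\<bar> powr (\<gamma> - 1) \<le> M powr (dV - r j - r n)" by simp
        have "\<bar>spow (x n) \<rho> - spow a \<rho>\<bar> \<le> \<rho> * (2 * M powr r n) powr (\<rho> - 1) * \<bar>x n - a\<bar>"
          by (rule spow_diff_le_Lipschitz[OF g(2) xM aM])
        also have "(2 * M powr r n) powr (\<rho> - 1) = 2 powr (\<rho> - 1) * M powr (r n * (\<rho> - 1))"
          by (simp add: powr_mult powr_powr)
        also have "r n * (\<rho> - 1) = r j - r n" using rn by (simp add: \<rho>_def field_simps)
        finally have 2: "\<bar>spow (x n) \<rho> - spow a \<rho>\<bar> \<le> \<rho> * 2 powr (\<rho> - 1) * M powr (r j - r n) * w powr r n"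
          by (simp add: wn abs_minus_commute mult_ac)
        have "\<bar>W_y j (spow a \<rho>) (x n)\<bar> = \<gamma> * (\<bar>x n\<bar> powr (\<gamma> - 1) * \<bar>spow (x n) \<rho> - spow a \<rho>\<bar>)"
          unfolding W_y_def using g by (simp add: abs_mult flip: n_def \<gamma>_def \<rho>_def)
        also have "\<dots> \<le> \<gamma> * (M powr (dV - r j - r n) *
            (\<rho> * 2 powr (\<rho> - 1) * M powr (r j - r n) * w powr r n))"
          using 1 2 g by (intro mult_left_mono mult_mono) auto
        also have "\<dots> = K1 * (M powr ((dV - r j - r n) + (r j - r n)) * w powr r n)"
          unfolding powr_add K1_def by (simp add: mult_ac)
        finally show ?thesis by simp
      qed
      have "\<bar>drift x n\<bar> \<le> M powr r (Suc n)" using xi[of "Suc n"] n by (auto simp: drift_def)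
      moreover have "\<bar>s n\<bar> \<le> 2 powr \<theta> * M powr r (Suc n)"
      proof (cases "\<theta> = 0")
        case True
        then have "r (Suc n) = 0" using rn by (simp add: \<theta>_def)
        then show ?thesis using adm M n True by (auto simp: admissible_def selection_def)
      next
        case False
        then have "\<bar>s n\<bar> = \<bar>a\<bar> powr \<theta>" using adm n
          by (auto simp: admissible_def selection_def \<theta>_def)
        also have "\<dots> \<le> 2 powr \<theta> * M powr (r n * \<theta>)"
          using aM g by (intro powr_le_of_weighted_le) auto
        finally show ?thesis using rn by (simp add: \<theta>_def)
      qed
      then have "\<bar>\<kappa> * s n\<bar> \<le> \<bar>\<kappa>\<bar> * (2 powr \<theta> * M powr r (Suc n))"
        unfolding abs_mult by (intro mult_left_mono) auto
      ultimately have J: "\<bar>drift x n - \<kappa> * s n\<bar> \<le> K2 * M powr r (Suc n)"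
        using abs_triangle_ineq4[of "drift x n" "\<kappa> * s n"]
        by (simp add: K2_def algebra_simps del: abs_triangle_ineq4)
      have "W_y j (spow a \<rho>) (x n) * (drift x n - \<kappa> * s n)
        \<le> \<bar>W_y j (spow a \<rho>) (x n)\<bar> * \<bar>drift x n - \<kappa> * s n\<bar>"
        unfolding abs_mult[symmetric] by (rule abs_ge_self)
      also have "\<dots> \<le> (K1 * (M powr (dV - 2 * r n) * w powr r n)) * (K2 * M powr r (Suc n))"
        using H J K by (intro mult_mono) auto
      also have "\<dots> = K1 * K2 * (M powr (dV - 2 * r n + r (Suc n)) * w powr r n)"
        unfolding powr_add by (simp add: mult_ac)
      finally show ?thesis by (simp flip: p_def R_def w_def M_def)
    qed
  qed
  then show ?thesis unfolding n_def[symmetric] \<rho>_def[symmetric]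
    using K p rn by (intro negligible_chainI[where K = "K1 * K2" and p = p and q = "r n"] n) auto
qed

text \<open>Adapts a selection to the driving variable \<open>y\<close>. Among
  \<open>i \<le> m\<close> the exponent \<open>0\<close> occurs at most for \<open>i = m\<close>;
  that value is kept, so no jump enters the error terms.\<close>

definition reselect :: "nat \<Rightarrow> real \<Rightarrow> (nat \<Rightarrow> real) \<Rightarrow> nat \<Rightarrow> real" where
  "reselect n y s i = (if r (Suc i) = 0 then s i else spow y (r (Suc i) / r n))"

lemma admissible_reselect:
  "n \<le> m \<Longrightarrow> admissible n a s \<Longrightarrow> admissible n y (reselect n y s)"
  by (auto simp: admissible_def reselect_def selection_def)

text \<open>As \<open>r (Suc i) \<le> r n\<close>, the signed power is Hoelder continuous in the
  driving variable, which yields a positive power of \<open>a - x n\<close>. At exponent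
  \<open>0\<close> the difference is zero.\<close>

lemma negligible_reselect:
  assumes "n \<in> {1..m}" "i \<in> {n..m}"
  shows "negligible_wrt (\<lambda>(x, a, s). admissible n a s)
    (\<lambda>(x, a, s). grad n l x i * (\<kappa> * (reselect n (x n) s i - s i)))
    (\<lambda>(x, a, s). hsize n x) (\<lambda>(x, a, s). \<bar>a - x n\<bar> powr (D / r n))"
proof (cases "r (Suc i) = 0")
  case True
  have "(\<lambda>(x, a :: real, s). grad n l x i * (\<kappa> * (reselect n (x n) s i - s i))) = (\<lambda>t. 0)"
    using True by (auto simp: reselect_def fun_eq_iff)
  then show ?thesis using hsize_nonneg by (simp add: negligible_wrt_0 split: prod.splits)
next
  case False
  then have ri: "r (Suc i) > 0" "r i < dV" "r n > 0" "r (Suc i) \<le> r n"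
    using r_Suc_nonneg[of i] r_less_dV[of i] r_mono[of n "Suc i"] assms by auto
  obtain K where K: "0 \<le> K" "\<And>R x. (\<And>i. i \<in> {n..m} \<Longrightarrow> \<bar>x i\<bar> \<le> R powr r i) \<Longrightarrow>
    \<bar>grad n l x i\<bar> \<le> K * R powr (dV - r i)"
    using grad_bound[of n i l] assms by auto
  have "grad n l x i * (\<kappa> * (reselect n (x n) s i - s i))
    \<le> (K * (\<bar>\<kappa>\<bar> * 2)) * ((hsize n x powr (1 / D) + \<bar>a - x n\<bar> powr (1 / r n)) powr (dV - r i)
                      * (\<bar>a - x n\<bar> powr (1 / r n)) powr r (Suc i))"
    if adm: "admissible n a s" for x a s
  proof -
    define R where "R = hsize n x powr (1 / D)"
    define w where "w = \<bar>a - x n\<bar> powr (1 / r n)"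
    have nn: "0 \<le> R" "0 \<le> w" by (auto simp: R_def w_def)
    have "s i = spow a (r (Suc i) / r n)"
      using adm assms False ri by (auto simp: admissible_def selection_def)
    then have "\<bar>reselect n (x n) s i - s i\<bar> = \<bar>spow (x n) (r (Suc i) / r n) - spow a (r (Suc i) / r n)\<bar>"
      using False by (simp add: reselect_def)
    also have "\<dots> \<le> 2 * \<bar>x n - a\<bar> powr (r (Suc i) / r n)"
      using ri by (intro spow_diff_le_Hoelder) auto
    also have "\<dots> = 2 * w powr r (Suc i)"
      by (simp add: w_def powr_powr abs_minus_commute)
    finally have 1: "\<bar>\<kappa> * (reselect n (x n) s i - s i)\<bar> \<le> \<bar>\<kappa>\<bar> * (2 * w powr r (Suc i))"
      unfolding abs_mult by (intro mult_left_mono) auto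
    have "\<bar>grad n l x i\<bar> \<le> K * R powr (dV - r i)"
      unfolding R_def by (rule K(2)) (rule abs_le_hsize)
    also have "\<dots> \<le> K * (R + w) powr (dV - r i)"
      using K nn ri by (intro mult_left_mono powr_mono2) auto
    finally have 2: "\<bar>grad n l x i\<bar> \<le> K * (R + w) powr (dV - r i)" .
    have "grad n l x i * (\<kappa> * (reselect n (x n) s i - s i))
      \<le> \<bar>grad n l x i\<bar> * \<bar>\<kappa> * (reselect n (x n) s i - s i)\<bar>"
      unfolding abs_mult[of "grad n l x i", symmetric] by (rule abs_ge_self)
    also have "\<dots> \<le> (K * (R + w) powr (dV - r i)) * (\<bar>\<kappa>\<bar> * (2 * w powr r (Suc i)))"
      using 1 2 K by (intro mult_mono) auto
    finally show ?thesis by (simp add: mult_ac flip: R_def w_def)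
  qed
  then show ?thesis using K ri assms
    by (intro negligible_chainI[where K = "K * (\<bar>\<kappa>\<bar> * 2)" and p = "dV - r i" and q = "r (Suc i)"])
      (auto simp: D_def r_Suc)
qed

text \<open>A selection \<open>t\<close> that fits the sign of \<open>a\<close> but not that of \<open>y\<close> forces
  \<open>\<bar>y\<bar> \<le> \<bar>a - y\<bar>\<close>. This replaces Hoelder continuity of the signed power when its exponent is \<open>0\<close>.\<close>

lemma penalty_reselect:
  assumes "n \<in> {1..m}" "admissible n a s"
  shows "penalty n y (reselect n y s m)
    \<le> 2 powr (D / r n) * (penalty n a (s m) + \<bar>a - y\<bar> powr (D / r n))"
proof -
  define p where "p = D / r n"
  have p: "p > 0" using D_pos assms by (simp add: p_def)
  then have p2: "2 powr p \<ge> 1" by (simp add: ge_one_powr_ge_zero)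
  have nn: "0 \<le> penalty n a (s m)" by (simp add: penalty_def)
  have rhs: "0 \<le> 2 powr p * (penalty n a (s m) + \<bar>a - y\<bar> powr p)" using nn by simp
  have "penalty n y (reselect n y s m) \<le> 2 powr p * (penalty n a (s m) + \<bar>a - y\<bar> powr p)"
  proof (cases "reselect n y s m \<in> spow_set y (r (Suc m) / r n)")
    case True
    then show ?thesis using rhs by (simp add: penalty_def)
  next
    case notin: False
    then have z: "r (Suc m) = 0"
      using r_nonzero[of n] assms(1) by (auto simp: reselect_def spow_set_def split: if_splits)
    then have ny: "s m \<notin> sign_set y" using notin by (simp add: reselect_def spow_set_def)
    have lhs: "penalty n y (reselect n y s m) = \<bar>y\<bar> powr p"
      using notin by (simp add: penalty_def p_def)
    show ?thesis
    proof (cases "s m \<in> sign_set a")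
      case True
      then have "\<bar>y\<bar> \<le> \<bar>a - y\<bar>"
        using ny by (auto simp: sign_set_def split: if_splits)
      then have "\<bar>y\<bar> powr p \<le> 1 * \<bar>a - y\<bar> powr p" using p by (simp add: powr_mono2)
      also have "\<dots> \<le> 2 powr p * (penalty n a (s m) + \<bar>a - y\<bar> powr p)"
        using p2 nn by (intro mult_mono) auto
      finally show ?thesis using lhs by simp
    next
      case False
      then have "penalty n a (s m) = \<bar>a\<bar> powr p" by (simp add: penalty_def p_def z spow_set_def)
      moreover have "\<bar>y\<bar> powr p \<le> (\<bar>a\<bar> + \<bar>a - y\<bar>) powr p" using p by (intro powr_mono2) auto
      moreover have "(\<bar>a\<bar> + \<bar>a - y\<bar>) powr p \<le> 2 powr p * (\<bar>a\<bar> powr p + \<bar>a - y\<bar> powr p)"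
        using p by (intro powr_add_le2) auto
      ultimately show ?thesis using lhs by simp
    qed
  qed
  then show ?thesis by (simp add: p_def)
qed

text \<open>The selection driven by \<open>a\<close> is exchanged for one driven by
  \<open>x (Suc j)\<close>, to which \<open>IH\<close> applies. The exchange error and the coupling
  term are negligible, and half of the decay absorbs their small part.\<close>

lemma perturbed_subchain:
  assumes "1 \<le> j" "j < m" "lam > 0" "C' \<ge> 0"
    and IH: "\<And>x s. admissible (Suc j) (x (Suc j)) s \<Longrightarrow>
      Vdot (Suc j) l k x s \<le> - lam * hsize (Suc j) x + C' * penalty (Suc j) (x (Suc j)) (s m)"
  obtains C where "C \<ge> 0" "\<And>x a s. admissible (Suc j) a s \<Longrightarrow>
    W_y j (spow a (r j / r (Suc j))) (x (Suc j)) * (drift x (Suc j) - k (Suc j) * s (Suc j))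
      + Vdot (Suc j) l k x s
    \<le> - (lam / 2) * hsize (Suc j) x
      + C * (\<bar>a - x (Suc j)\<bar> powr (D / r (Suc j)) + penalty (Suc j) a (s m))"
proof -
  define n where "n = Suc j"
  have n: "n \<in> {1..m}" "n \<le> m" using assms by (auto simp: n_def)
  define E where "E = (\<lambda>x a s. W_y j (spow a (r j / r n)) (x n) * (drift x n - k n * s n)
    + (\<Sum>i = n..m. grad n l x i * (k i * (reselect n (x n) s i - s i))))"
  define coupling where "coupling = (\<lambda>(x, a, s :: nat \<Rightarrow> real).
    W_y j (spow a (r j / r n)) (x n) * (drift x n - k n * s n))"
  define resel where "resel = (\<lambda>i (x, a :: real, s). grad n l x i * (k i * (reselect n (x n) s i - s i)))"
  have "negligible_wrt (\<lambda>(x, a, s). admissible n a s) (\<lambda>t. coupling t + (\<Sum>i = n..m. resel i t))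
    (\<lambda>(x, a, s). hsize n x) (\<lambda>(x, a, s). \<bar>a - x n\<bar> powr (D / r n))"
  proof (rule negligible_wrt_add[OF _ negligible_wrt_sum])
    show "negligible_wrt (\<lambda>(x, a, s). admissible n a s) coupling
      (\<lambda>(x, a, s). hsize n x) (\<lambda>(x, a, s). \<bar>a - x n\<bar> powr (D / r n))"
      unfolding coupling_def n_def by (rule negligible_coupling[OF assms(1,2)])
    show "negligible_wrt (\<lambda>(x, a, s). admissible n a s) (resel i)
      (\<lambda>(x, a, s). hsize n x) (\<lambda>(x, a, s). \<bar>a - x n\<bar> powr (D / r n))" if "i \<in> {n..m}" for i
      unfolding resel_def by (rule negligible_reselect[OF n(1) that])
  qed (auto simp: hsize_nonneg)
  then obtain C where C: "C \<ge> 0"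
    "\<And>t. (case t of (x, a, s) \<Rightarrow> admissible n a s) \<Longrightarrow> coupling t + (\<Sum>i = n..m. resel i t)
      \<le> lam / 2 * (case t of (x, a, s) \<Rightarrow> hsize n x) + C * (case t of (x, a, s) \<Rightarrow> \<bar>a - x n\<bar> powr (D / r n))"
    using assms(3) unfolding negligible_wrt_def by (meson half_gt_zero)
  have CE: "E x a s \<le> lam / 2 * hsize n x + C * \<bar>a - x n\<bar> powr (D / r n)" if "admissible n a s" for x a s
    using C(2)[of "(x, a, s)"] that by (simp add: E_def coupling_def resel_def)
  define B where "B = C' * 2 powr (D / r n)"
  have B: "B \<ge> 0" using assms by (simp add: B_def)
  have "W_y j (spow a (r j / r n)) (x n) * (drift x n - k n * s n) + Vdot n l k x s
    \<le> - (lam / 2) * hsize n x + (B + C) * (\<bar>a - x n\<bar> powr (D / r n) + penalty n a (s m))"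
    if adm: "admissible n a s" for x a s
  proof -
    \<comment> \<open>\<open>Vdot\<close> is affine in the selection, so the exchange is an exact
      identity.\<close>
    have "Vdot n l k x s = Vdot n l k x (reselect n (x n) s)
        + (\<Sum>i = n..m. grad n l x i * (k i * (reselect n (x n) s i - s i)))"
      unfolding Vdot_def sum.distrib[symmetric] by (intro sum.cong) (auto simp: algebra_simps)
    then have eq: "W_y j (spow a (r j / r n)) (x n) * (drift x n - k n * s n) + Vdot n l k x s
        = Vdot n l k x (reselect n (x n) s) + E x a s" by (simp add: E_def)
    have "Vdot n l k x (reselect n (x n) s)
      \<le> - lam * hsize n x + C' * penalty n (x n) (reselect n (x n) s m)"
      using IH admissible_reselect[OF n(2) adm] by (simp add: n_def)
    also have "\<dots> \<le> - lam * hsize n x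
        + C' * (2 powr (D / r n) * (penalty n a (s m) + \<bar>a - x n\<bar> powr (D / r n)))"
      using penalty_reselect[OF n(1) adm] assms by (intro add_left_mono mult_left_mono) auto
    finally have 1: "Vdot n l k x (reselect n (x n) s)
        \<le> - lam * hsize n x + B * (\<bar>a - x n\<bar> powr (D / r n) + penalty n a (s m))"
      by (simp add: B_def algebra_simps)
    have "0 \<le> C * penalty n a (s m)" using C by (simp add: penalty_def)
    then show ?thesis using 1 CE[OF adm, of x] unfolding eq by (simp add: algebra_simps)
  qed
  then show ?thesis using B C by (intro that[of "B + C"]) (auto simp: n_def)
qed

section \<open>The induction step: prepending a variable\<close>

text \<open>\<open>grad n\<close> reads \<open>l (i - 1)\<close> only for \<open>i > n\<close>, so a
  gain with smaller index can be chosen after those of the subchain.\<close>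

lemma grad_Suc_cong:
  assumes "\<And>i. n \<le> i \<Longrightarrow> l i = l' i" "n \<le> i"
  shows "grad n l x i = grad n l' x i"
  using assms by (auto simp: grad_def)

text \<open>The only new term of the Lyapunov function is \<open>W j\<close>; its
  \<open>z\<close>-derivative acts along equation \<open>j\<close>, its \<open>y\<close>-derivative
  along equation \<open>Suc j\<close>.\<close>

lemma Vdot_split:
  assumes "j < m"
  shows "Vdot j l k x s = l j * W_z j (l j * x j) (x (Suc j)) * (x (Suc j) - k j * s j)
    + W_y j (l j * x j) (x (Suc j)) * (drift x (Suc j) - k (Suc j) * s (Suc j))
    + Vdot (Suc j) l k x s"
proof -
  have eq: "grad j l x i = grad (Suc j) l x i + (if i = Suc j then W_y j (l j * x j) (x (Suc j)) else 0)"
    if "i \<in> {Suc j..m}" for i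
    using that by (auto simp: grad_def)
  have "Vdot j l k x s = grad j l x j * (drift x j - k j * s j)
      + (\<Sum>i = Suc j..m. grad j l x i * (drift x i - k i * s i))"
    unfolding Vdot_def using assms by (simp add: sum.atLeast_Suc_atMost)
  also have "(\<Sum>i = Suc j..m. grad j l x i * (drift x i - k i * s i)) =
     (\<Sum>i = Suc j..m. grad (Suc j) l x i * (drift x i - k i * s i)
        + (if i = Suc j then W_y j (l j * x j) (x (Suc j)) * (drift x (Suc j) - k (Suc j) * s (Suc j)) else 0))"
    by (intro sum.cong refl) (auto simp: eq algebra_simps)
  also have "\<dots> = Vdot (Suc j) l k x s
      + W_y j (l j * x j) (x (Suc j)) * (drift x (Suc j) - k (Suc j) * s (Suc j))"
    unfolding sum.distrib Vdot_def using assms by simp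
  finally show ?thesis using assms by (simp add: grad_def[of j l x j] drift_def[of x j])
qed

text \<open>In the variable \<open>a = spow (L * x j) (r n / r j)\<close> with \<open>n = Suc j\<close>, the gains below
  turn the correction of the subchain \<open>x\<^sub>n, \<dots>, x\<^sub>m\<close> into the one driven by \<open>a\<close> in place of
  \<open>x n\<close>, while \<open>L\<close> multiplies the term that penalises \<open>a \<noteq> x n\<close>.\<close>

lemma stabilisable_step:
  assumes "1 \<le> j" "j < m" "stabilisable (Suc j)"
  shows "stabilisable j"
proof -
  define n where "n = Suc j"
  have n: "n \<in> {1..m}" "n \<le> m" using assms by (auto simp: n_def)
  have rn: "r n > 0" "r j > 0" "r n \<le> r j" "r j < dV" "r j + r n < dV"
    using assms n r_Suc_le[of j] r_less_dV[of j] r_sum_less[of j] by (auto simp: n_def)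
  obtain k' l' lam C' where *: "\<forall>i\<in>{n..m}. k' i > 0" "\<forall>i\<in>{n..<m}. l' i > 0" "lam > 0" "C' \<ge> 0"
    "\<And>x s. admissible n (x n) s \<Longrightarrow> Vdot n l' k' x s \<le> - lam * hsize n x + C' * penalty n (x n) (s m)"
    using assms(3) unfolding stabilisable_def n_def by blast
  obtain C where C: "C \<ge> 0" "\<And>x a s. admissible n a s \<Longrightarrow>
    W_y j (spow a (r j / r n)) (x n) * (drift x n - k' n * s n) + Vdot n l' k' x s
    \<le> - (lam / 2) * hsize n x + C * (\<bar>a - x n\<bar> powr (D / r n) + penalty n a (s m))"
    using perturbed_subchain[OF assms(1,2) *(3,4)] *(5) unfolding n_def by metis
  define \<gamma> where "\<gamma> = (dV - r j) / r n"
  have g: "\<gamma> \<ge> 1" "\<gamma> + 1 = D / r n"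
    using rn by (auto simp: \<gamma>_def D_def n_def r_Suc field_simps)
  define c :: real where "c = (1/2) powr \<gamma>"
  have c: "c > 0" by (simp add: c_def)
  \<comment> \<open>\<open>L * c \<ge> C + 1\<close> cancels the error \<open>C * \<delta>\<close>
    below and leaves one \<open>\<delta>\<close> of decay; \<open>L \<ge> 1\<close> makes
    \<open>z = L * x j\<close> dominate \<open>x j\<close>.\<close>
  define L where "L = max 1 ((C + 1) / c)"
  have L: "L \<ge> 1" "L * c \<ge> C + 1" using c by (auto simp: L_def field_simps max_def)
  then have L0: "L > 0" by simp
  define l where "l = l'(j := L)"
  define k where "k = (\<lambda>i. if i = j then L powr (r n / r j) else k' i * L powr (r (Suc i) / r j))"
  define B :: real where "B = 2 powr (D / r n)"
  have B: "B \<ge> 0" by (simp add: B_def)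
  \<comment> \<open>The decay is at least \<open>min 1 (lam / 2)\<close> times
    \<open>hsize n x + \<delta>\<close>, and \<open>B + 1\<close> compares this sum with
    \<open>hsize j x\<close>.\<close>
  define mu where "mu = min 1 (lam / 2) / (B + 1)"
  have mu: "mu > 0" using * B by (simp add: mu_def)
  have "Vdot j l k x s \<le> - mu * hsize j x + (C * L powr (D / r j)) * penalty j (x j) (s m)"
    if adm: "admissible j (x j) s" for x s
  proof -
    define y where "y = x n"
    define z where "z = L * x j"
    define a where "a = spow z (r n / r j)"
    have za: "spow a (r j / r n) = z" using rn by (simp add: a_def spow_spow)
    \<comment> \<open>The rescaling turns signed powers of \<open>x j\<close> into those of
      \<open>a\<close>; as \<open>L powr 0 = 1\<close>, a value at exponent \<open>0\<close> is
      unchanged.\<close>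
    define s' where "s' = (\<lambda>i. L powr (r (Suc i) / r j) * s i)"
    have sel: "selection (r (Suc i) / r j) (x j) (s i)" if "i \<in> {j..m}" for i
      using adm that by (simp add: admissible_def)
    have a_eq: "spow a (q / r n) = L powr (q / r j) * spow (x j) (q / r j)" for q
      using rn L0 by (simp add: a_def z_def spow_spow spow_scale powr_powr)
    have adm': "admissible n a s'"
      unfolding admissible_def
    proof
      fix i assume i: "i \<in> {n..m}"
      then have "selection (r (Suc i) / r j) (x j) (s i)" by (intro sel) (auto simp: n_def)
      then show "selection (r (Suc i) / r n) a (s' i)"
        using rn L0 by (auto simp: selection_def s'_def a_eq)
    qed
    have ks: "k i * s i = k' i * s' i" if "i \<ge> n" for i
      using that by (simp add: k_def s'_def n_def)
    \<comment> \<open>The exponent \<open>r n / r j\<close> is positive, so \<open>s j\<close> is a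
      genuine signed power and the gain \<open>k j\<close> makes the correction exactly
      \<open>a\<close>.\<close>
    have kj: "k j * s j = a"
      using sel[of j] assms rn L0 by (simp add: selection_def k_def a_def z_def spow_scale flip: n_def)
    have V1: "Vdot n l k x s = Vdot n l' k' x s'"
      unfolding Vdot_def
    proof (intro sum.cong refl arg_cong2[where f = "(*)"])
      fix i assume "i \<in> {n..m}"
      then show "grad n l x i = grad n l' x i" "drift x i - k i * s i = drift x i - k' i * s' i"
        by (auto intro!: grad_Suc_cong simp: l_def n_def ks)
    qed
    \<comment> \<open>In terms of \<open>a\<close> the derivative is a difference of equal powers,
      as coercivity requires.\<close>
    have Wz: "W_z j z y = spow a \<gamma> - spow y \<gamma>"
      using a_eq[of "dV - r j"] rn L0
      by (simp add: W_z_def \<gamma>_def z_def spow_scale flip: n_def)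
    have "l j * x j = z" by (simp add: l_def z_def)
    then have V: "Vdot j l k x s = L * ((spow a \<gamma> - spow y \<gamma>) * (y - a))
        + (W_y j (spow a (r j / r n)) y * (drift x n - k' n * s' n) + Vdot n l' k' x s')"
      using Vdot_split[OF assms(2), of l k x s] V1 Wz ks[of n] kj
      by (simp add: za l_def y_def flip: n_def)
    define \<delta> where "\<delta> = \<bar>a - y\<bar> powr (D / r n)"
    have d: "\<delta> \<ge> 0" by (simp add: \<delta>_def)
    have "(a - y) * (spow a \<gamma> - spow y \<gamma>) \<ge> c * \<delta>"
      using spow_coercive[OF g(1), of a y] by (simp add: c_def \<delta>_def g)
    then have "L * (c * \<delta>) \<le> L * ((a - y) * (spow a \<gamma> - spow y \<gamma>))"
      using L0 by (intro mult_left_mono) auto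
    moreover have "(C + 1) * \<delta> \<le> (L * c) * \<delta>" using L d by (intro mult_right_mono) auto
    moreover have "L * ((spow a \<gamma> - spow y \<gamma>) * (y - a)) = - (L * ((a - y) * (spow a \<gamma> - spow y \<gamma>)))"
      by (simp add: algebra_simps)
    ultimately have 1: "L * ((spow a \<gamma> - spow y \<gamma>) * (y - a)) \<le> - ((C + 1) * \<delta>)"
      by (simp add: mult.assoc)
    have 2: "Vdot j l k x s \<le> - \<delta> - (lam / 2) * hsize n x + C * penalty n a (s' m)"
      using 1 C(2)[OF adm', of x] unfolding V by (simp add: \<delta>_def y_def algebra_simps)
    \<comment> \<open>A nonzero left side requires exponent \<open>0\<close>, where
      \<open>s' m = s m\<close>. Since \<open>a\<close> and \<open>x j\<close> have the same sign,
      the penalties then differ only by scaling.\<close>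
    have 3: "penalty n a (s' m) \<le> L powr (D / r j) * penalty j (x j) (s m)"
    proof (cases "s' m \<in> spow_set a (r (Suc m) / r n)")
      case False
      have "r (Suc m) = 0"
      proof (rule ccontr)
        assume "r (Suc m) \<noteq> 0"
        then show False using False adm' n rn by (auto simp: admissible_def selection_def spow_set_def)
      qed
      then have "s m \<notin> sign_set a" using False L0 by (simp add: s'_def spow_set_def)
      moreover have "sgn a = sgn (x j)" using L0 by (simp add: a_def z_def sgn_mult)
      then have "sign_set a = sign_set (x j)" by (auto simp: sign_set_def sgn_if split: if_splits)
      ultimately have "penalty j (x j) (s m) = \<bar>x j\<bar> powr (D / r j)"
        using \<open>r (Suc m) = 0\<close> by (simp add: penalty_def spow_set_def)
      moreover have "penalty n a (s' m) = \<bar>a\<bar> powr (D / r n)" using False by (simp add: penalty_def)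
      moreover have "\<bar>a\<bar> powr (D / r n) = L powr (D / r j) * \<bar>x j\<bar> powr (D / r j)"
        using rn L0 by (simp add: a_def z_def powr_powr abs_mult powr_mult)
      ultimately show ?thesis by simp
    qed (simp add: penalty_def)
    \<comment> \<open>The new variable is controlled by \<open>a\<close>, and \<open>a\<close> by
      \<open>y\<close> and \<open>a - y\<close>.\<close>
    have 4: "hsize j x \<le> (B + 1) * (hsize n x + \<delta>)"
    proof -
      have "\<bar>x j\<bar> \<le> \<bar>z\<bar>" using L by (simp add: z_def abs_mult mult_le_cancel_right1)
      then have "\<bar>x j\<bar> powr (D / r j) \<le> \<bar>z\<bar> powr (D / r j)"
        using rn D_pos by (intro powr_mono2) auto
      also have "\<dots> = \<bar>a\<bar> powr (D / r n)" using rn by (simp add: a_def powr_powr)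
      also have "\<dots> \<le> (\<bar>y\<bar> + \<bar>a - y\<bar>) powr (D / r n)"
        using rn D_pos by (intro powr_mono2) auto
      also have "\<dots> \<le> B * (\<bar>y\<bar> powr (D / r n) + \<delta>)"
        unfolding B_def \<delta>_def using rn D_pos by (intro powr_add_le2) auto
      also have "\<bar>y\<bar> powr (D / r n) \<le> hsize n x"
        unfolding y_def hsize_def by (rule member_le_sum) (use n in auto)
      finally have "\<bar>x j\<bar> powr (D / r j) \<le> B * (hsize n x + \<delta>)"
        using B by (simp add: mult_left_mono)
      moreover have "hsize j x = \<bar>x j\<bar> powr (D / r j) + hsize n x"
        unfolding hsize_def n_def using assms by (simp add: sum.atLeast_Suc_atMost)
      ultimately show ?thesis using d by (simp add: algebra_simps)
    qed
    have "mu * hsize j x \<le> mu * ((B + 1) * (hsize n x + \<delta>))"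
      using 4 mu by (intro mult_left_mono) auto
    also have "\<dots> = min 1 (lam / 2) * (hsize n x + \<delta>)" using B by (simp add: mu_def)
    also have "\<dots> \<le> (lam / 2) * hsize n x + 1 * \<delta>"
      unfolding distrib_left using d hsize_nonneg by (intro add_mono mult_right_mono) auto
    finally have 5: "mu * hsize j x \<le> (lam / 2) * hsize n x + \<delta>" by simp
    have "C * penalty n a (s' m) \<le> C * L powr (D / r j) * penalty j (x j) (s m)"
      using mult_left_mono[OF 3 C(1)] by (simp add: mult.assoc)
    then show ?thesis using 2 5 by linarith
  qed
  moreover have "\<forall>i\<in>{j..m}. k i > 0" "\<forall>i\<in>{j..<m}. l i > 0"
    using * L0 by (auto simp: k_def l_def n_def)
  moreover have "C * L powr (D / r j) \<ge> 0" using C by simp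
  ultimately show ?thesis unfolding stabilisable_def using mu by blast
qed

lemma stabilisable_1: "stabilisable 1"
  using m_ge_1
proof (induction rule: inc_induct)
  case base
  show ?case by (rule stabilisable_m)
next
  case (step j)
  then show ?case using stabilisable_step by auto
qed

subsection \<open>The Lyapunov function\<close>

lemma W_nonneg:
  assumes "1 \<le> i" "i < m"
  shows "W i z y \<ge> 0"
proof -
  have ri: "r i > 0" "r i < dV" "r (Suc i) > 0" using assms r_less_dV[of i] by auto
  let ?b = "\<bar>y\<bar> powr ((dV - r i) / r (Suc i))"
  have "\<bar>z\<bar> * ?b \<le> \<bar>z\<bar> powr (dV / r i) / (dV / r i) + ?b powr (dV / (dV - r i)) / (dV / (dV - r i))"
    using ri by (intro Youngs_inequality) (auto simp: field_simps)
  also have "\<dots> = r i / dV * \<bar>z\<bar> powr (dV / r i) + (1 - r i / dV) * \<bar>y\<bar> powr (dV / r (Suc i))"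
  proof -
    have b: "?b powr (dV / (dV - r i)) = \<bar>y\<bar> powr (dV / r (Suc i))"
      using ri by (simp add: powr_powr)
    show ?thesis unfolding b using ri by (simp add: field_simps)
  qed
  finally have "\<bar>z\<bar> * ?b \<le> \<dots>" .
  moreover have "z * spow y ((dV - r i) / r (Suc i)) \<le> \<bar>z\<bar> * ?b"
    using abs_ge_self[of "z * spow y ((dV - r i) / r (Suc i))"] unfolding abs_mult abs_spow .
  ultimately show ?thesis unfolding W_def by linarith
qed

lemma W_bound:
  assumes "1 \<le> i" "i < m" "0 \<le> c"
  obtains K where "0 \<le> K" "\<And>R z y. \<bar>z\<bar> \<le> c * R powr r i \<Longrightarrow> \<bar>y\<bar> \<le> R powr r (Suc i) \<Longrightarrow>
    W i z y \<le> K * R powr dV"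
proof -
  have ri: "r i > 0" "r i < dV" "r (Suc i) > 0" using assms r_less_dV[of i] by auto
  define K where "K = r i / dV * c powr (dV / r i) + (1 - r i / dV) + c"
  have "W i z y \<le> K * R powr dV"
    if "\<bar>z\<bar> \<le> c * R powr r i" "\<bar>y\<bar> \<le> R powr r (Suc i)" for R z y
  proof -
    have "\<bar>z\<bar> powr (dV / r i) \<le> c powr (dV / r i) * R powr (r i * (dV / r i))"
      using that ri assms dV_gt_1 by (intro powr_le_of_weighted_le) auto
    then have 1: "r i / dV * \<bar>z\<bar> powr (dV / r i) \<le> r i / dV * (c powr (dV / r i) * R powr dV)"
      using ri by (intro mult_left_mono) auto
    have "\<bar>y\<bar> powr (dV / r (Suc i)) \<le> 1 powr (dV / r (Suc i)) * R powr (r (Suc i) * (dV / r (Suc i)))"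
      using that ri by (intro powr_le_of_weighted_le) auto
    then have 2: "(1 - r i / dV) * \<bar>y\<bar> powr (dV / r (Suc i)) \<le> (1 - r i / dV) * R powr dV"
      using ri by (intro mult_left_mono) auto
    have "\<bar>y\<bar> powr ((dV - r i) / r (Suc i))
      \<le> 1 powr ((dV - r i) / r (Suc i)) * R powr (r (Suc i) * ((dV - r i) / r (Suc i)))"
      using that ri by (intro powr_le_of_weighted_le) auto
    then have "\<bar>z * spow y ((dV - r i) / r (Suc i))\<bar> \<le> (c * R powr r i) * R powr (dV - r i)"
      unfolding abs_mult abs_spow using that(1) ri assms by (intro mult_mono) auto
    also have "\<dots> = c * R powr (r i + (dV - r i))" unfolding powr_add by simp
    finally have 3: "- (z * spow y ((dV - r i) / r (Suc i))) \<le> c * R powr dV"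
      unfolding abs_le_iff by simp
    have "W i z y \<le> r i / dV * (c powr (dV / r i) * R powr dV) + (1 - r i / dV) * R powr dV + c * R powr dV"
      unfolding W_def using 1 2 3 by linarith
    also have "\<dots> = K * R powr dV" by (simp add: K_def distrib_right)
    finally show ?thesis .
  qed
  moreover have "0 \<le> K" unfolding K_def using ri assms dV_gt_1 by (intro add_nonneg_nonneg mult_nonneg_nonneg) auto
  ultimately show ?thesis using that by blast
qed

text \<open>At the lower limit both terms of the antiderivative are multiples of
  \<open>\<bar>y\<bar> powr (dV / r (Suc i))\<close>, whence the coefficient
  \<open>1 - r i / dV\<close>. Orientation of the integral makes this valid for either order of the
  limits.\<close>

lemma integral_eq_W:
  assumes "1 \<le> i" "i < m"
  shows "(LBINT t = ereal (spow y (r i / r (Suc i)))..ereal z.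
    spow t ((dV - r i) / r i) - spow y ((dV - r i) / r (Suc i))) = W i z y"
proof -
  have ri: "r i > 0" "r i < dV" "r (Suc i) > 0" using assms r_less_dV[of i] by auto
  let ?b = "spow y ((dV - r i) / r (Suc i))" and ?a = "spow y (r i / r (Suc i))"
  let ?f = "\<lambda>t. spow t ((dV - r i) / r i) - ?b"
  define F where "F t = r i / dV * \<bar>t\<bar> powr (dV / r i) - ?b * t" for t
  have "((\<lambda>t. \<bar>t\<bar> powr (dV / r i)) has_real_derivative dV / r i * spow t (dV / r i - 1)) (at t)" for t
    using ri by (intro DERIV_abs_powr) auto
  then have F: "(F has_real_derivative ?f t) (at t)" for t
    unfolding F_def using DERIV_diff[OF DERIV_cmult DERIV_cmult_Id, of _ _ t UNIV "r i / dV" ?b] ri dV_gt_1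
    by (fastforce simp: diff_divide_distrib)
  have "(LBINT t = ereal ?a..ereal z. ?f t) = F z - F ?a"
  proof (rule interval_integral_FTC_finite)
    show "continuous_on {min ?a z..max ?a z} ?f"
      using ri by (intro continuous_intros continuous_on_spow) auto
  qed (use F in \<open>auto simp flip: has_real_derivative_iff_has_vector_derivative
        intro: has_field_derivative_at_within\<close>)
  also have "\<dots> = W i z y"
  proof -
    have "\<bar>?a\<bar> powr (dV / r i) = \<bar>y\<bar> powr (dV / r (Suc i))" using ri by (simp add: powr_powr)
    moreover have "?b * ?a = \<bar>y\<bar> powr (dV / r (Suc i))"
      by (simp add: spow_mult_spow flip: add_divide_distrib)
    ultimately show ?thesis by (simp add: F_def W_def algebra_simps)
  qed
  finally show ?thesis .
qed

text \<open>All three exponents exceed \<open>1\<close>, so the chain rule applies even where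
  \<open>f\<close> or \<open>g\<close> vanishes.\<close>

lemma W_has_derivative:
  assumes "1 \<le> i" "i < m" "(f has_derivative f') (at e)" "(g has_derivative g') (at e)"
  shows "((\<lambda>e. W i (f e) (g e)) has_derivative
    (\<lambda>h. W_z i (f e) (g e) * f' h + W_y i (f e) (g e) * g' h)) (at e)"
proof -
  have ri: "r i > 0" "r i < dV" "r (Suc i) > 0" "r (Suc i) \<le> r i" "r i + r (Suc i) < dV"
    using assms r_less_dV[of i] r_sum_less[of i] r_Suc_le[of i] by auto
  let ?p = "dV / r i" and ?q = "dV / r (Suc i)"
  define \<gamma> where "\<gamma> = (dV - r i) / r (Suc i)"
  have pq: "?p > 1" "?q > 1" "\<gamma> > 1" using ri by (auto simp: \<gamma>_def field_simps)
  note D = DERIV_compose_FDERIV[OF DERIV_abs_powr[OF pq(1)] assms(3)]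
    DERIV_compose_FDERIV[OF DERIV_abs_powr[OF pq(2)] assms(4)]
    DERIV_compose_FDERIV[OF DERIV_spow[OF pq(3)] assms(4)] assms(3)
  have "((\<lambda>e. r i / dV * \<bar>f e\<bar> powr ?p + (1 - r i / dV) * \<bar>g e\<bar> powr ?q - f e * spow (g e) \<gamma>)
    has_derivative (\<lambda>h. r i / dV * (f' h * (?p * spow (f e) (?p - 1)))
       + (1 - r i / dV) * (g' h * (?q * spow (g e) (?q - 1)))
       - (f e * (g' h * (\<gamma> * \<bar>g e\<bar> powr (\<gamma> - 1))) + f' h * spow (g e) \<gamma>))) (at e)"
    by (intro has_derivative_diff has_derivative_add has_derivative_mult_right has_derivative_mult D)
  moreover have "(\<lambda>h. r i / dV * (f' h * (?p * spow (f e) (?p - 1)))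
       + (1 - r i / dV) * (g' h * (?q * spow (g e) (?q - 1)))
       - (f e * (g' h * (\<gamma> * \<bar>g e\<bar> powr (\<gamma> - 1))) + f' h * spow (g e) \<gamma>))
     = (\<lambda>h. W_z i (f e) (g e) * f' h + W_y i (f e) (g e) * g' h)"
  proof
    fix h
    \<comment> \<open>This exponent identity extracts the common factor
      \<open>\<bar>g e\<bar> powr (\<gamma> - 1)\<close> of \<open>W_y\<close>.\<close>
    have "\<gamma> - 1 + r i / r (Suc i) = ?q - 1" using ri by (simp add: \<gamma>_def field_simps)
    then have 1: "spow (g e) (?q - 1) = \<bar>g e\<bar> powr (\<gamma> - 1) * spow (g e) (r i / r (Suc i))"
      by (simp only: abs_powr_mult_spow)
    have 2: "(1 - r i / dV) * (g' h * (?q * t)) = \<gamma> * (g' h * t)" for t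
      using ri by (simp add: \<gamma>_def field_simps)
    have 3: "r i / dV * (f' h * (?p * t)) = f' h * t" for t using ri by simp
    have 4: "?p - 1 = (dV - r i) / r i" using ri by (simp add: field_simps)
    show "r i / dV * (f' h * (?p * spow (f e) (?p - 1)))
       + (1 - r i / dV) * (g' h * (?q * spow (g e) (?q - 1)))
       - (f e * (g' h * (\<gamma> * \<bar>g e\<bar> powr (\<gamma> - 1))) + f' h * spow (g e) \<gamma>)
     = W_z i (f e) (g e) * f' h + W_y i (f e) (g e) * g' h"
      unfolding 1 2 3 4 W_z_def W_y_def \<gamma>_def[symmetric] by (simp add: algebra_simps)
  qed
  ultimately show ?thesis unfolding W_def \<gamma>_def by simp
qed

definition Vseq :: "(nat \<Rightarrow> real) \<Rightarrow> (nat \<Rightarrow> real) \<Rightarrow> real" where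
  "Vseq l x = (\<Sum>i = 1..<m. W i (l i * x i) (x (Suc i))) + \<bar>x m\<bar> powr dV / dV"

lemma Vseq_nonneg: "Vseq l x \<ge> 0"
  unfolding Vseq_def using dV_gt_1 by (intro add_nonneg_nonneg sum_nonneg W_nonneg) auto

text \<open>At the largest index \<open>n\<close> with \<open>x n \<noteq> 0\<close>, either
  \<open>n = m\<close> and the last summand is positive, or \<open>W n\<close> is evaluated at
  \<open>y = 0\<close>, where only a pure power of \<open>z\<close> remains.\<close>

lemma Vseq_pos:
  assumes "\<And>i. i \<in> {1..<m} \<Longrightarrow> l i > 0" "i \<in> {1..m}" "x i \<noteq> 0"
  shows "Vseq l x > 0"
proof -
  define n where "n = Max {i \<in> {1..m}. x i \<noteq> 0}"
  have "n \<in> {i \<in> {1..m}. x i \<noteq> 0}" unfolding n_def using assms by (intro Max_in) auto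
  then have n: "1 \<le> n" "n \<le> m" "x n \<noteq> 0" by auto
  have zero: "x i = 0" if "n < i" "i \<le> m" for i
  proof (rule ccontr)
    assume "x i \<noteq> 0"
    then have "i \<le> n" unfolding n_def using that n(1) by (intro Max_ge) auto
    with that show False by simp
  qed
  have W: "0 \<le> W i (l i * x i) (x (Suc i))" if "i \<in> {1..<m}" for i
    using that by (intro W_nonneg) auto
  show ?thesis
  proof (cases "n = m")
    case True
    then have "\<bar>x m\<bar> powr dV / dV > 0" using n dV_gt_1 by auto
    moreover have "0 \<le> (\<Sum>i = 1..<m. W i (l i * x i) (x (Suc i)))" by (intro sum_nonneg W)
    ultimately show ?thesis by (simp add: Vseq_def)
  next
    case False
    then have nm: "n \<in> {1..<m}" using n by auto
    have "W n (l n * x n) 0 > 0"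
      using nm n assms(1)[OF nm] dV_gt_1 by (auto simp: W_def)
    then have "0 < W n (l n * x n) (x (Suc n))" using zero[of "Suc n"] nm by simp
    also have "\<dots> \<le> (\<Sum>i = 1..<m. W i (l i * x i) (x (Suc i)))"
      by (rule member_le_sum) (use nm W in auto)
    finally show ?thesis using dV_gt_1 by (simp add: Vseq_def add_pos_nonneg)
  qed
qed

text \<open>\<open>Vseq\<close> has degree \<open>dV\<close> and \<open>hsize\<close> degree
  \<open>D\<close>; the power \<open>D / dV\<close> equalises them. This converts decay measured by
  \<open>hsize\<close> into decay measured by \<open>V\<close>.\<close>

lemma Vseq_le_hsize:
  obtains K where "K > 0" "\<And>x. Vseq l x powr (D / dV) \<le> K * hsize 1 x"
proof -
  have "\<exists>K\<ge>0. \<forall>R z y. \<bar>z\<bar> \<le> \<bar>l i\<bar> * R powr r i \<longrightarrow> \<bar>y\<bar> \<le> R powr r (Suc i) \<longrightarrow>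
    W i z y \<le> K * R powr dV" if "i \<in> {1..<m}" for i
    using W_bound[of i "\<bar>l i\<bar>"] that by (metis abs_ge_zero atLeastLessThan_iff)
  then obtain K where K: "\<And>i. i \<in> {1..<m} \<Longrightarrow> K i \<ge> 0" "\<And>i R z y. i \<in> {1..<m} \<Longrightarrow>
      \<bar>z\<bar> \<le> \<bar>l i\<bar> * R powr r i \<Longrightarrow> \<bar>y\<bar> \<le> R powr r (Suc i) \<Longrightarrow> W i z y \<le> K i * R powr dV"
    by metis
  define B where "B = (\<Sum>i = 1..<m. K i) + 1 / dV"
  have B: "B > 0" unfolding B_def using K(1) dV_gt_1 by (intro add_nonneg_pos sum_nonneg) auto
  have "Vseq l x powr (D / dV) \<le> B powr (D / dV) * hsize 1 x" for x
  proof -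
    define R where "R = hsize 1 x powr (1 / D)"
    have xi: "\<bar>x i\<bar> \<le> R powr r i" if "i \<in> {1..m}" for i
      unfolding R_def by (rule abs_le_hsize[OF that])
    have "(\<Sum>i = 1..<m. W i (l i * x i) (x (Suc i))) \<le> (\<Sum>i = 1..<m. K i * R powr dV)"
      by (intro sum_mono K(2)) (auto simp: abs_mult intro!: mult_left_mono xi)
    moreover have "\<bar>x m\<bar> powr dV \<le> 1 powr dV * R powr (r m * dV)"
      using xi[of m] m_ge_1 dV_gt_1 by (intro powr_le_of_weighted_le) auto
    then have "\<bar>x m\<bar> powr dV / dV \<le> R powr dV / dV"
      using dV_gt_1 by (simp add: divide_right_mono)
    ultimately have "Vseq l x \<le> B * R powr dV"
      by (simp add: Vseq_def B_def sum_distrib_right distrib_right)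
    then have "Vseq l x powr (D / dV) \<le> (B * R powr dV) powr (D / dV)"
      using Vseq_nonneg D_pos dV_gt_1 by (intro powr_mono2) auto
    also have "\<dots> = B powr (D / dV) * hsize 1 x"
      using B D_pos dV_gt_1 hsize_nonneg[of 1 x] by (simp add: powr_mult powr_powr R_def)
    finally show ?thesis .
  qed
  then show ?thesis using B by (intro that[of "B powr (D / dV)"]) auto
qed

text \<open>Regroups the derivative by coordinates: the contribution of \<open>W_y i\<close> belongs
  to coordinate \<open>Suc i\<close>.\<close>

lemma sum_grad:
  "(\<Sum>i = 1..<m. W_z i (l i * x i) (x (Suc i)) * (l i * h i) + W_y i (l i * x i) (x (Suc i)) * h (Suc i))
     + spow (x m) (dV - 1) * h m = (\<Sum>i = 1..m. grad 1 l x i * h i)"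
proof -
  have ins: "{1..m} = insert m {1..<m}" "{1..m} = insert 1 {Suc 1..m}" using m_ge_1 by auto
  define A where "A i = (if i = m then spow (x m) (dV - 1) else l i * W_z i (l i * x i) (x (Suc i))) * h i" for i
  define B where "B i = (if 1 < i then W_y (i - 1) (l (i - 1) * x (i - 1)) (x i) else 0) * h i" for i
  have "(\<Sum>i = 1..m. grad 1 l x i * h i) = (\<Sum>i = 1..m. A i) + (\<Sum>i = 1..m. B i)"
    by (simp add: grad_def A_def B_def distrib_right sum.distrib)
  also have "(\<Sum>i = 1..m. A i)
      = spow (x m) (dV - 1) * h m + (\<Sum>i = 1..<m. W_z i (l i * x i) (x (Suc i)) * (l i * h i))"
    unfolding ins(1) by (simp add: A_def mult_ac)
  \<comment> \<open>The first coordinate has no predecessor, so \<open>B 1 = 0\<close> and the index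
    can be shifted.\<close>
  also have "(\<Sum>i = 1..m. B i) = (\<Sum>i = Suc 1..m. B i)"
    unfolding ins(2) by (simp add: B_def)
  also have "\<dots> = (\<Sum>i = 1..<m. B (Suc i))"
    using sum.shift_bounds_Suc_ivl[of B 1 m] by (simp add: atLeastLessThanSuc_atLeastAtMost)
  also have "\<dots> = (\<Sum>i = 1..<m. W_y i (l i * x i) (x (Suc i)) * h (Suc i))"
    by (simp add: B_def)
  finally show ?thesis by (simp add: sum.distrib)
qed

end

section \<open>Transfer to vectors\<close>

lemma coord_0 [simp]: "coord pos 0 i = 0"
  by (simp add: coord_def)

lemma coord_add: "coord pos (u + v) i = coord pos u i + coord pos v i"
  by (simp add: coord_def)

lemma coord_has_derivative: "((\<lambda>e. coord pos e i) has_derivative (\<lambda>h. coord pos h i)) F"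
  unfolding coord_def by (intro bounded_linear_imp_has_derivative bounded_linear_vec_nth)

lemma coord_chi:
  fixes pos :: "'m::finite \<Rightarrow> nat"
  assumes "bij_betw pos UNIV {1..CARD('m)}" "i \<in> {1..CARD('m)}"
  shows "coord pos (\<chi> j. f (pos j)) i = f i"
  using assms by (simp add: coord_def bij_betw_def f_inv_into_f)

lemma nonzero_coord:
  fixes pos :: "'m::finite \<Rightarrow> nat"
  assumes "bij_betw pos UNIV {1..CARD('m)}" "e \<noteq> 0"
  obtains i where "i \<in> {1..CARD('m)}" "coord pos e i \<noteq> 0"
proof -
  obtain j where "e $ j \<noteq> 0" using assms(2) by (auto simp: vec_eq_iff)
  moreover have "inv pos (pos j) = j" "pos j \<in> {1..CARD('m)}"
    using assms(1) by (auto simp: bij_betw_def)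
  ultimately show ?thesis by (intro that[of "pos j"]) (auto simp: coord_def)
qed

theorem proposition6:
  fixes pos :: "'m::finite \<Rightarrow> nat" and d0 dV :: real
  assumes "bij_betw pos UNIV {1..CARD('m)}"
    and "d0 \<in> {-1..0}"
    and "dV > 2 * real CARD('m) - 1"
  shows "(\<forall>l :: nat \<Rightarrow> real. (\<forall>i\<in>{1..<CARD('m)}. l i > 0) \<longrightarrow> positive_definite (V pos d0 dV l)) \<and>
    (\<exists>(k :: nat \<Rightarrow> real) (l :: nat \<Rightarrow> real) (lam :: real).
       (\<forall>i\<in>{1..CARD('m)}. k i > 0) \<and> (\<forall>i\<in>{1..<CARD('m)}. l i > 0) \<and> lam > 0 \<and>
       (\<forall>e :: real ^ 'm.
          V pos d0 dV l differentiable (at e) \<and>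
          (\<exists>M. is_maximum (V_dot_set pos d0 dV l k e) M \<and>
               M \<le> - lam * V pos d0 dV l e powr ((dV + d0) / dV))))"
proof -
  interpret homogeneous_chain "CARD('m)" d0 dV
    using assms by unfold_locales auto
  let ?m = "CARD('m)"
  have V_eq: "V pos d0 dV l e = Vseq l (coord pos e)" for l e
    unfolding V_def Let_def Vseq_def r_def[symmetric] Suc_eq_plus1[symmetric]
    by (intro arg_cong2[where f = "(+)"] sum.cong refl integral_eq_W) auto
  have pd: "positive_definite (V pos d0 dV l)" if l: "\<forall>i\<in>{1..<?m}. l i > 0" for l
    unfolding positive_definite_def
  proof (intro conjI allI impI)
    show "V pos d0 dV l 0 = 0" by (simp add: V_eq Vseq_def W_def)
    fix e :: "real ^ 'm" assume "e \<noteq> 0"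
    then obtain i where "i \<in> {1..?m}" "coord pos e i \<noteq> 0" using nonzero_coord assms(1) by blast
    then show "V pos d0 dV l e > 0" unfolding V_eq using l by (intro Vseq_pos[of l i]) auto
  qed
  have V_deriv: "(V pos d0 dV l has_derivative
      (\<lambda>h. \<Sum>i = 1..?m. grad 1 l (coord pos e) i * coord pos h i)) (at e)" for l e
  proof -
    have last: "((\<lambda>e. \<bar>coord pos e ?m\<bar> powr dV / dV) has_derivative
      (\<lambda>h. spow (coord pos e ?m) (dV - 1) * coord pos h ?m)) (at e)"
      using has_derivative_mult_right[OF DERIV_compose_FDERIV[OF DERIV_abs_powr[OF dV_gt_1]
        coord_has_derivative[of pos ?m "at e"]], of "1 / dV"] dV_gt_1
      by (simp add: mult_ac)
    have "((\<lambda>e. Vseq l (coord pos e)) has_derivative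
      (\<lambda>h. (\<Sum>i = 1..<?m. W_z i (l i * coord pos e i) (coord pos e (Suc i)) * (l i * coord pos h i)
            + W_y i (l i * coord pos e i) (coord pos e (Suc i)) * coord pos h (Suc i))
          + spow (coord pos e ?m) (dV - 1) * coord pos h ?m)) (at e)"
      unfolding Vseq_def
      by (intro has_derivative_add has_derivative_sum W_has_derivative last
          has_derivative_mult_right coord_has_derivative) auto
    then show ?thesis unfolding sum_grad by (simp add: V_eq[abs_def])
  qed
  obtain k l lam C where kl: "\<forall>i\<in>{1..?m}. k i > 0" "\<forall>i\<in>{1..<?m}. l i > 0" "lam > 0"
    "\<And>x s. admissible 1 (x 1) s \<Longrightarrow> Vdot 1 l k x s \<le> - lam * hsize 1 x + C * penalty 1 (x 1) (s ?m)"
    using stabilisable_1 unfolding stabilisable_def by blast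
  obtain K where K: "K > 0" "\<And>x. Vseq l x powr (D / dV) \<le> K * hsize 1 x"
    using Vseq_le_hsize[of l] by blast
  have "\<exists>M. is_maximum (V_dot_set pos d0 dV l k e) M \<and>
               M \<le> - (lam / K) * V pos d0 dV l e powr ((dV + d0) / dV)" for e
  proof -
    define x where "x = coord pos e"
    define S where "S i = spow_set (x 1) (r (Suc i) / r 1)" for i
    have correction: "\<kappa> \<in> correction pos d0 k (x 1) \<longleftrightarrow> (\<forall>i\<in>{1..?m}. \<exists>s\<in>S i. coord pos \<kappa> i = - k i * s)" for \<kappa>
      by (simp add: correction_def S_def r_def)
    have shift: "coord pos (shift pos e) i = drift x i" if "i \<in> {1..?m}" for i
      unfolding shift_def
      using coord_chi[OF assms(1) that, of "\<lambda>i. if i < ?m then coord pos e (i + 1) else 0"]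
      by (simp add: drift_def x_def)
    have deriv: "frechet_derivative (V pos d0 dV l) (at e) (shift pos e + \<kappa>) = Vdot 1 l k x s"
      if "\<And>i. i \<in> {1..?m} \<Longrightarrow> coord pos \<kappa> i = - k i * s i" for \<kappa> s
    proof -
      have "frechet_derivative (V pos d0 dV l) (at e) (shift pos e + \<kappa>)
        = (\<Sum>i = 1..?m. grad 1 l x i * coord pos (shift pos e + \<kappa>) i)"
        unfolding frechet_derivative_at[OF V_deriv, symmetric] by (simp add: x_def)
      also have "\<dots> = Vdot 1 l k x s"
        unfolding Vdot_def by (intro sum.cong refl) (simp add: coord_add shift that)
      finally show ?thesis .
    qed
    \<comment> \<open>The derivative is a sum over components, and the components of the correction
      vary independently. Maximising each summand over its compact set therefore attains the
      maximum.\<close>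
    have "\<exists>s\<in>S i. \<forall>t\<in>S i. grad 1 l x i * (drift x i - k i * t) \<le> grad 1 l x i * (drift x i - k i * s)" for i
      unfolding S_def
      by (intro continuous_attains_sup compact_spow_set spow_set_nonempty continuous_intros)
    then obtain s where s: "\<And>i. s i \<in> S i"
      "\<And>i t. t \<in> S i \<Longrightarrow> grad 1 l x i * (drift x i - k i * t) \<le> grad 1 l x i * (drift x i - k i * s i)"
      by metis
    have "is_maximum (V_dot_set pos d0 dV l k e) (Vdot 1 l k x s)"
      unfolding is_maximum_def
    proof
      define \<kappa> :: "real ^ 'm" where "\<kappa> = (\<chi> j. - k (pos j) * s (pos j))"
      have \<kappa>: "coord pos \<kappa> i = - k i * s i" if "i \<in> {1..?m}" for i
        unfolding \<kappa>_def by (rule coord_chi[OF assms(1) that])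
      then have "\<kappa> \<in> correction pos d0 k (x 1)" unfolding correction using s(1) by blast
      then show "Vdot 1 l k x s \<in> V_dot_set pos d0 dV l k e"
        unfolding V_dot_set_def x_def[symmetric]
        by (rule rev_image_eqI) (rule deriv[symmetric], rule \<kappa>)
      show "\<forall>v\<in>V_dot_set pos d0 dV l k e. v \<le> Vdot 1 l k x s"
      proof
        fix v assume "v \<in> V_dot_set pos d0 dV l k e"
        then obtain \<kappa> where "\<kappa> \<in> correction pos d0 k (x 1)"
          and v: "v = frechet_derivative (V pos d0 dV l) (at e) (shift pos e + \<kappa>)"
          unfolding V_dot_set_def x_def by blast
        then obtain t where t: "\<And>i. i \<in> {1..?m} \<Longrightarrow> t i \<in> S i" "\<And>i. i \<in> {1..?m} \<Longrightarrow> coord pos \<kappa> i = - k i * t i"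
          unfolding correction by metis
        have "v = Vdot 1 l k x t" unfolding v by (rule deriv[OF t(2)])
        also have "\<dots> \<le> Vdot 1 l k x s"
          unfolding Vdot_def by (intro sum_mono s(2) t(1))
        finally show "v \<le> Vdot 1 l k x s" .
      qed
    qed
    moreover have "Vdot 1 l k x s \<le> - (lam / K) * V pos d0 dV l e powr ((dV + d0) / dV)"
    proof -
      \<comment> \<open>The values in \<open>S i\<close> are admissible, and being genuine values of
        the set-valued power they make the penalty vanish.\<close>
      have "selection (r (Suc i) / r 1) (x 1) (s i)" for i
        using s(1)[of i] by (auto simp: S_def selection_def spow_set_def sign_set_def split: if_splits)
      then have "Vdot 1 l k x s \<le> - lam * hsize 1 x + C * penalty 1 (x 1) (s ?m)"
        by (intro kl(4)) (simp add: admissible_def)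
      also have "penalty 1 (x 1) (s ?m) = 0"
        using s(1)[of ?m] by (simp add: penalty_def S_def)
      also have "- lam * hsize 1 x + C * 0 \<le> - (lam / K) * Vseq l x powr (D / dV)"
        using mult_left_mono[OF K(2)[of x], of "lam / K"] K(1) kl(3) by simp
      finally show ?thesis by (simp add: V_eq x_def D_def)
    qed
    ultimately show ?thesis by blast
  qed
  moreover have "lam / K > 0" using kl K by simp
  moreover have "V pos d0 dV l differentiable (at e)" for e
    using V_deriv unfolding differentiable_def by blast
  ultimately show ?thesis using pd kl(1,2) by blast
qed

end
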